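(* Let $d\ge2$ be fixed. There are constants $C_1,C_2>0$ depending only on $d$ such that the following holds. Let $D$ be a dataset of $n$ $d$-dimensional tuples, $r\ge1$ an integer, $\delta,\epsilon\in(0,1)$, $m=\lceil C_1\, r\ln n/\delta^2\rceil$ and $\gamma=\lceil C_2/\epsilon\rceil$. Let $\mathbb{D}=\mathbb{D}_a\cup\mathbb{D}_b$ be the discrete vector set built with parameters $m,\gamma$, so that $|\mathbb{D}|\le(\gamma+1)^{d-1}+m$, and suppose $\left\lfloor\frac{r-d}{1+\ln|\mathbb{D}|}\right\rfloor\ge1$. Let $k^*$ be the minimum of $\nabla_{\mathbb{S}}(S)$ over nonempty $S\subseteq D$ with $|S|\le\frac{r-d}{1+\ln|\mathbb{D}|}$. Then the algorithm HDRRM run on $(D,r,\gamma,m)$ returns a set $R\subseteq D$ such that (1) $\nabla_{\mathbb{D}}(R)\le k^*$ and $|R|\le r$; (2) for any user, whose utility vector $u$ is distributed uniformly on $\mathbb{S}$ independently of $\mathbb{D}_a$, with probability at least $1-\delta$ (over $u$ and $\mathbb{D}_a$) one has $\nabla_u(R)\le k^*$; (3) for all $u\in\mathbb{S}$, $w(u,R)\ge(1-\epsilon)\,w_{k^*}(u,D)$.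
   Context: A dataset $D$ is a set of $n$ distinct tuples in $[0,1]^d$ such that for each attribute $i$ there is a tuple $b_i\in D$ with $b_i[i]=1$ (boundary tuple, one fixed for each $i$); the basis is $B=\{b_1,\dots,b_d\}$. The utility of $t$ for a nonnegative vector $u\in\mathbb{R}^d$ is $w(u,t)=\sum_i u[i]t[i]$; $w_k(u,D)$ is the $k$-th highest utility (with multiplicity) of tuples of $D$, and $w(u,S)=\max_{t\in S}w(u,t)$. The rank $\nabla_u(t)$ is one plus the number of $t'\in D$ with $w(u,t')>w(u,t)$; $\nabla_u(S)=\min_{t\in S}\nabla_u(t)$, $\nabla_{\mathbb{V}}(S)=\max_{u\in\mathbb{V}}\nabla_u(S)$ for a set $\mathbb{V}$ of vectors, and $\Phi_k(u,D)=\{t\in D:\nabla_u(t)\le k\}$. $\mathbb{S}=\{u\in\mathbb{R}^d: u[i]\ge0\ \forall i,\ \|u\|_2=1\}$. $\mathbb{D}_a$ is a set of $m$ independent samples from the uniform distribution on $\mathbb{S}$. $\mathbb{D}_b\subseteq\mathbb{S}$ is the image of the grid $\{(\frac{z_1\pi}{2\gamma},\dots,\frac{z_{d-1}\pi}{2\gamma}): z_i\in\{0,1,\dots,\gamma\}\}$ under the polar map $(\theta[1],\dots,\theta[d-1])\mapsto u$, $u[i]=\sin(\theta[d-1])\cdots\sin(\theta[i])\cos(\theta[i-1])$ for $1\le i\le d$, with $\theta[0]=0$. Algorithm ASMS on $(D,k,B,\mathbb{D})$: let $\mathbb{D}_k$ be the set of $u\in\mathbb{D}$ such that $\Phi_k(u,D)\cap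 B=\emptyset$; for $t\in D$ let $V_{\mathbb{D}_k}(t)=\{u\in\mathbb{D}_k: t\in\Phi_k(u,D)\}$; run the greedy set-cover algorithm (repeatedly pick the set containing the most uncovered elements until all are covered) on ground set $\mathbb{D}_k$ with the nonempty sets $V_{\mathbb{D}_k}(t)$, $t\in D$; return $Q$, the union of $B$ and the tuples $t$ whose sets were picked. Algorithm HDRRM on $(D,r,\gamma,m)$: construct $\mathbb{D}$ and $B$; set $k=1$. While $k\le n$: let $Q=\mathrm{ASMS}(D,k,B,\mathbb{D})$; if $|Q|\le r$, set $R=Q$ and exit the loop; otherwise set $k=2k$. Then set $low=k/2+1$, $high=k$. While $low<high$: set $k=\lfloor(low+high)/2\rfloor$ and $Q=\mathrm{ASMS}(D,k,B,\mathbb{D})$; if $|Q|\le r$ set $high=k$ and $R=Q$, else set $low=k+1$. Return $R$. *)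

theory Defs
  imports "HOL-Probability.Probability" "HOL-Library.While_Combinator"
begin

text \<open>The utility of a tuple \<open>t\<close> for a vector \<open>u\<close> is the inner product \<open>u \<bullet> t\<close>. Indices of
  coordinates form a finite linear order, so that the coordinates can be numbered
  \<open>1, \<dots>, d\<close> with \<open>d = CARD('n)\<close>, as the polar map requires.\<close>

definition is_dataset :: "(real^'n) set \<Rightarrow> bool" where
  "is_dataset D \<longleftrightarrow> finite D \<and> (\<forall>t\<in>D. \<forall>i. 0 \<le> t $ i \<and> t $ i \<le> 1) \<and> (\<forall>i. \<exists>t\<in>D. t $ i = 1)"

definition boundary_tuples :: "(real^'n) set \<Rightarrow> ('n \<Rightarrow> real^'n) \<Rightarrow> bool" where
  "boundary_tuples D b \<longleftrightarrow> (\<forall>i. b i \<in> D \<and> b i $ i = 1)"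

definition max_utility :: "real^'n \<Rightarrow> (real^'n) set \<Rightarrow> real" where
  "max_utility u S = Max ((\<lambda>t. u \<bullet> t) ` S)"

definition kth_utility :: "nat \<Rightarrow> real^'n \<Rightarrow> (real^'n) set \<Rightarrow> real" where
  "kth_utility k u D = rev (sorted_list_of_multiset {#u \<bullet> t. t \<in># mset_set D#}) ! (k - 1)"

definition tuple_rank :: "(real^'n) set \<Rightarrow> real^'n \<Rightarrow> real^'n \<Rightarrow> nat" where
  "tuple_rank D u t = 1 + card {t' \<in> D. u \<bullet> t' > u \<bullet> t}"

definition set_rank :: "(real^'n) set \<Rightarrow> real^'n \<Rightarrow> (real^'n) set \<Rightarrow> nat" where
  "set_rank D u S = Min (tuple_rank D u ` S)"

text \<open>For \<open>D\<close> finite and \<open>S\<close> a nonempty subset of \<open>D\<close>, the ranks are at most \<open>card D\<close>,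
  so the maximum below is over a finite set of values even if \<open>V\<close> is infinite.\<close>

definition max_rank :: "(real^'n) set \<Rightarrow> (real^'n) set \<Rightarrow> (real^'n) set \<Rightarrow> nat" where
  "max_rank D V S = Max ((\<lambda>u. set_rank D u S) ` V)"

definition top_tuples :: "nat \<Rightarrow> real^'n \<Rightarrow> (real^'n) set \<Rightarrow> (real^'n) set" where
  "top_tuples k u D = {t \<in> D. tuple_rank D u t \<le> k}"

definition nonneg_sphere :: "(real^'n) set" where
  "nonneg_sphere = {u. (\<forall>i. 0 \<le> u $ i) \<and> norm u = 1}"

text \<open>The uniform distribution (normalised surface measure) on the nonnegative part of the unit
  sphere, as a measure on the Borel sets of the ambient space: the radial projection
  \<open>x \<mapsto> x / norm x\<close> of the uniform distribution on the nonnegative part of the unit ball.\<close>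

definition uniform_nonneg_sphere :: "(real^'n) measure" where
  "uniform_nonneg_sphere =
     distr (uniform_measure lborel {x. (\<forall>i. 0 \<le> x $ i) \<and> norm x \<le> 1}) borel sgn"

definition sample_space :: "nat \<Rightarrow> (nat \<Rightarrow> real^'n) measure" where
  "sample_space m = Pi\<^sub>M {..<m} (\<lambda>_. uniform_nonneg_sphere)"

definition coord_no :: "'n::{finite,linorder} \<Rightarrow> nat" where
  "coord_no i = card {j. j \<le> i}"

text \<open>The angles are \<open>\<theta> 1, \<dots>, \<theta> (d - 1)\<close>; the value \<open>\<theta> 0\<close> is overridden by \<open>0\<close>.\<close>

definition polar_map :: "(nat \<Rightarrow> real) \<Rightarrow> real^('n::{finite,linorder})" where
  "polar_map \<theta> = (\<chi> i. (\<Prod>j = coord_no i..CARD('n) - 1. sin (\<theta> j)) * cos ((\<theta>(0 := 0)) (coord_no i - 1)))"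

definition polar_grid :: "nat \<Rightarrow> (real^('n::{finite,linorder})) set" where
  "polar_grid \<gamma> =
     {polar_map (\<lambda>j. real (z j) * pi / (2 * real \<gamma>)) | z. \<forall>j\<in>{1..CARD('n) - 1}. z j \<in> {0..\<gamma>}}"

definition discrete_dirs ::
    "nat \<Rightarrow> nat \<Rightarrow> (nat \<Rightarrow> real^('n::{finite,linorder})) \<Rightarrow> (real^('n::_)) set" where
  "discrete_dirs \<gamma> m \<omega> = \<omega> ` {..<m} \<union> polar_grid \<gamma>"

text \<open>A tie-breaking rule for the greedy algorithm: \<open>\<tau> k P A\<close> is the index chosen among
  the maximisers \<open>A\<close> in the call with threshold \<open>k\<close> when \<open>P\<close> has already been picked. Since \<open>P\<close>
  grows in every round, each possible run of the nondeterministic algorithm arises from such a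
  rule.\<close>

type_synonym 'a tie_rule = "nat \<Rightarrow> 'a set \<Rightarrow> 'a set \<Rightarrow> 'a"

definition is_tie_rule :: "'a tie_rule \<Rightarrow> bool" where
  "is_tie_rule \<tau> \<longleftrightarrow> (\<forall>k P A. A \<noteq> {} \<longrightarrow> \<tau> k P A \<in> A)"

text \<open>Greedy set cover of \<open>U\<close> by the family \<open>V t\<close>, \<open>t \<in> I\<close>; the result is the set of indices of
  the picked sets.\<close>

definition greedy_cover ::
    "('a set \<Rightarrow> 'a set \<Rightarrow> 'a) \<Rightarrow> 'b set \<Rightarrow> 'a set \<Rightarrow> ('a \<Rightarrow> 'b set) \<Rightarrow> 'a set" where
  "greedy_cover pick U I V =
     while (\<lambda>P. U - (\<Union>t\<in>P. V t) \<noteq> {})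
       (\<lambda>P. let W = U - (\<Union>t\<in>P. V t);
                A = {t \<in> I. \<forall>t'\<in>I. card (V t' \<inter> W) \<le> card (V t \<inter> W)}
            in insert (pick P A) P) {}"

definition asms ::
    "(real^'n) tie_rule \<Rightarrow> (real^'n) set \<Rightarrow> nat \<Rightarrow> (real^'n) set \<Rightarrow> (real^'n) set \<Rightarrow>
     (real^'n) set" where
  "asms \<tau> D k B \<D> =
     (let \<D>k = {u \<in> \<D>. top_tuples k u D \<inter> B = {}};
          V = (\<lambda>t. {u \<in> \<D>k. t \<in> top_tuples k u D})
      in B \<union> greedy_cover (\<tau> k) \<D>k {t \<in> D. V t \<noteq> {}} V)"

text \<open>The result \<open>None\<close> means that the variable \<open>R\<close> is never assigned. The sample vectors \<open>\<omega>\<close>,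
  the boundary tuples \<open>b\<close> and the tie-breaking rule \<open>\<tau>\<close> are explicit arguments.\<close>

definition hdrrm ::
    "(real^('n::{finite,linorder})) tie_rule \<Rightarrow> ('n \<Rightarrow> real^('n::_)) \<Rightarrow> (nat \<Rightarrow> real^('n::_)) \<Rightarrow>
     (real^('n::_)) set \<Rightarrow> nat \<Rightarrow> nat \<Rightarrow> nat \<Rightarrow> (real^('n::_)) set option" where
  "hdrrm \<tau> b \<omega> D r \<gamma> m =
     (let \<D> = discrete_dirs \<gamma> m \<omega>;
          B = range b;
          (k, R) =
            while (\<lambda>(k, R). k \<le> card D \<and> R = None)
              (\<lambda>(k, R). let Q = asms \<tau> D k B \<D>
                        in if card Q \<le> r then (k, Some Q) else (2 * k, None))
              (1, None);
          (low, high, R) =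
            while (\<lambda>(low, high, R). low < high)
              (\<lambda>(low, high, R). let k = (low + high) div 2; Q = asms \<tau> D k B \<D>
                                in if card Q \<le> r then (low, k, Some Q) else (k + 1, high, R))
              (k div 2 + 1, k, R)
      in R)"

definition opt_rank :: "(real^'n) set \<Rightarrow> real \<Rightarrow> nat" where
  "opt_rank D s =
     Min {max_rank D nonneg_sphere S | S. S \<subseteq> D \<and> S \<noteq> {} \<and> real (card S) \<le> s}"

end

theory Submission
  imports Defs "HOL-Analysis.Harmonic_Numbers"
begin

text \<open>Write \<open>k*\<close> for the optimal rank. If \<open>S\<close> realises \<open>k*\<close>, then for every \<open>k \<ge> k*\<close> the sets of \<open>S\<close>
  cover the instance solved by ASMS, so greedy set cover picks at most \<open>|S| (1 + ln |\<D>|) \<le> r - d\<close>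
  tuples and the call succeeds. Hence a threshold at which ASMS fails lies below \<open>k*\<close>, and the search ends
  at a successful threshold \<open>k \<le> k*\<close>.

  For the utility guarantee, the polar grid is a net of mesh \<open>O(1/\<gamma>)\<close> in the sphere, and the boundary
  tuples keep the maximal utility of \<open>R\<close> above \<open>1/d\<close>, which turns the additive error into a relative one.

  For the probabilistic guarantee, a fixed pair \<open>(R, k)\<close> whose failure set has measure more than
  \<open>\<delta>/2\<close> is missed by all \<open>m\<close> samples with probability at most \<open>exp (- m \<delta> / 2)\<close>, and there are
  at most \<open>n ^ (r + 1)\<close> pairs. The event is measurable because the output of the algorithm depends on the
  samples only through the number of directions of \<open>\<D>\<close> with each given set of top tuples.\<close>

section \<open>Greedy set cover\<close>

text \<open>Two obstacles shape the proof. Moreover both R and k* are random: k* depends on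
  \<open>card \<D>\<close>, which drops when samples coincide with one another or with grid points.
  The failure set is thus selected by the very samples that test it, hence a union over pairs (R,
  k). The events "the outcome is (R, k)" are disjoint, so all pairs with failure measure at most
  \<delta>/2 together cost only \<delta>/2; the remaining ones cost at most n^(r+1) exp(-m
  \<delta>/2). In m, one factor 1/\<delta> balances this exponent, the other pays for a term
  ln(2/\<delta>), bounded crudely by 2/\<delta>. The tie-breaking rule is arbitrary, but it sees
  only the tuples picked and the maximisers, never the directions themselves. This is what lets
  counts of directions decide a whole run.\<close>

lemma harm_le_one_plus_ln:
  assumes "n \<ge> 1"
  shows "harm n \<le> 1 + ln (real n)"
  using euler_mascheroni_sequence_decreasing[of 1 n] assms by (simp add: harm_def)

text \<open>The difference consists of the last \<open>g\<close> terms of the harmonic sum, each at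
  least \<open>1 / n\<close>. It measures what one greedy round with gain \<open>g\<close> takes off
  the potential.\<close>

lemma harm_diff_ge:
  assumes "g \<le> n" "n \<ge> 1"
  shows "real g / real n \<le> harm n - harm (n - g)"
  using assms(1)
proof (induction g)
  case 0
  show ?case by simp
next
  case (Suc g)
  have "Suc (n - Suc g) = n - g"
    using Suc by simp
  then have "harm (n - g) = harm (n - Suc g) + inverse (real n - real g)"
    using harm_Suc[of "n - Suc g", where ?'a = real] Suc by (simp add: of_nat_diff)
  moreover have "inverse (real n) \<le> inverse (real n - real g)"
    using Suc assms(2) by (intro le_imp_inverse_le) auto
  moreover have "real (Suc g) / real n = real g / real n + inverse (real n)"
    by (simp add: add_divide_distrib inverse_eq_divide)
  moreover have "real g / real n \<le> harm n - harm (n - g)"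
    using Suc by simp
  ultimately show ?case
    by linarith
qed

text \<open>Since \<open>S\<close> covers the remaining set \<open>W P\<close>, one of its members
  covers at least \<open>|W P| / |S|\<close> points of it, and the greedy choice gains no less. By
  \<open>harm_diff_ge\<close> the term \<open>|S| * harm |W P|\<close> then drops by at least 1,
  which pays for the index picked.\<close>

lemma greedy_cover_harm_bound:
  fixes V :: "'a \<Rightarrow> 'b set"
  assumes fin: "finite U" "finite I" and pick: "\<And>P A. A \<noteq> {} \<Longrightarrow> pick P A \<in> A"
    and S: "S \<subseteq> I" "U \<subseteq> (\<Union>t\<in>S. V t)"
  defines "G \<equiv> greedy_cover pick U I V"
  shows "G \<subseteq> I \<and> U \<subseteq> (\<Union>t\<in>G. V t) \<and> real (card G) \<le> real (card S) * harm (card U)"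
proof -
  define W where "W = (\<lambda>P. U - (\<Union>t\<in>P. V t))"
  define A where "A = (\<lambda>P. {t \<in> I. \<forall>t'\<in>I. card (V t' \<inter> W P) \<le> card (V t \<inter> W P)})"
  define Inv where "Inv = (\<lambda>P. P \<subseteq> I \<and>
    real (card P) + real (card S) * harm (card (W P)) \<le> real (card S) * harm (card U))"
  have finS: "finite S"
    using S(1) fin(2) finite_subset by blast
  have finW: "finite (W P)" for P
    using fin(1) by (simp add: W_def)
  have step: "Inv (insert (pick P (A P)) P) \<and>
      card (W (insert (pick P (A P)) P)) < card (W P)" if inv: "Inv P" and ne: "W P \<noteq> {}" for P
  proof -
    define t where "t = pick P (A P)"
    define g where "g = card (V t \<inter> W P)"
    obtain x where x: "x \<in> W P" using ne by blast
    then obtain s where s: "s \<in> S" "x \<in> V s" using S(2) by (auto simp: W_def)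
    have "A P \<noteq> {}"
    proof -
      have "I \<noteq> {}" using s S(1) by auto
      then have "Max ((\<lambda>t. card (V t \<inter> W P)) ` I) \<in> (\<lambda>t. card (V t \<inter> W P)) ` I"
        using fin(2) by (intro Max_in) auto
      then obtain t where "t \<in> I" "card (V t \<inter> W P) = Max ((\<lambda>t. card (V t \<inter> W P)) ` I)"
        by auto
      then have "t \<in> A P" using fin(2) by (auto simp: A_def)
      then show ?thesis by auto
    qed
    then have tA: "t \<in> A P" unfolding t_def by (rule pick)
    then have tI: "t \<in> I" and tmax: "\<And>t'. t' \<in> I \<Longrightarrow> card (V t' \<inter> W P) \<le> g"
      by (auto simp: A_def g_def)
    \<comment> \<open>An uncovered point lies in some set of \<open>S\<close>, so the gain is
      positive; this makes \<open>card (W P)\<close> decrease and the loop terminate.\<close>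
    have "V s \<inter> W P \<noteq> {}" using s x by auto
    then have "card (V s \<inter> W P) > 0" using finW by (simp add: card_gt_0_iff)
    then have gpos: "g > 0" using tmax[of s] s S(1) by auto
    have Npos: "card (W P) \<ge> 1"
      using ne finW[of P] by (simp add: Suc_le_eq card_gt_0_iff)
    have "W P \<subseteq> (\<Union>s\<in>S. V s \<inter> W P)"
      using S(2) by (auto simp: W_def)
    then have "card (W P) \<le> card (\<Union>s\<in>S. V s \<inter> W P)"
      using finW finS by (intro card_mono) auto
    also have "\<dots> \<le> (\<Sum>s\<in>S. card (V s \<inter> W P))"
      by (rule card_UN_le[OF finS])
    also have "\<dots> \<le> (\<Sum>s\<in>S. g)"
      using S(1) tmax by (intro sum_mono) auto
    finally have N: "card (W P) \<le> card S * g" by simp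
    have eq: "W (insert t P) = W P - V t \<inter> W P" by (auto simp: W_def)
    have card': "card (W (insert t P)) = card (W P) - g"
      unfolding eq g_def using finW by (subst card_Diff_subset) auto
    have gle: "g \<le> card (W P)"
      unfolding g_def using finW by (intro card_mono) auto
    \<comment> \<open>The potential \<open>|P| + |S| harm |W P|\<close> does not increase in a round.\<close>
    have "1 \<le> real (card S) * (real g / real (card (W P)))"
    proof -
      have "real (card (W P)) \<le> real (card S) * real g"
        using N by (metis of_nat_le_iff of_nat_mult)
      then show ?thesis using Npos by (simp add: field_simps)
    qed
    also have "\<dots> \<le> real (card S) * (harm (card (W P)) - harm (card (W P) - g))"
      using harm_diff_ge[OF gle Npos] by (intro mult_left_mono) auto
    finally have "1 + real (card S) * harm (card (W (insert t P)))
        \<le> real (card S) * harm (card (W P))"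
      by (simp add: card' algebra_simps)
    moreover have "finite P"
      using inv fin(2) finite_subset by (auto simp: Inv_def)
    then have "card (insert t P) \<le> card P + 1"
      by (simp add: card_insert_if)
    ultimately have "Inv (insert t P)"
      using inv tI by (simp add: Inv_def)
    moreover have "card (W (insert t P)) < card (W P)"
      using card' gpos Npos by simp
    ultimately show ?thesis by (simp add: t_def)
  qed
  have G: "G = while (\<lambda>P. W P \<noteq> {}) (\<lambda>P. insert (pick P (A P)) P) {}"
    by (simp add: G_def greedy_cover_def W_def A_def Let_def)
  have "Inv G \<and> W G = {}"
    unfolding G
  proof (rule while_rule[where P = Inv and r = "Wellfounded.measure (\<lambda>P. card (W P))"])
    show "Inv {}" by (simp add: Inv_def W_def)
  qed (use step in auto)
  then have "G \<subseteq> I" "real (card G) + real (card S) * harm (card (W G)) \<le> real (card S) * harm (card U)"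
    and W: "W G = {}"
    by (auto simp only: Inv_def)
  moreover have "harm (card (W G)) = (0::real)"
    by (simp add: W harm_def)
  moreover have "U \<subseteq> (\<Union>t\<in>G. V t)"
    using W by (auto simp: W_def)
  ultimately show ?thesis
    by simp
qed

section \<open>Doubling and bisection\<close>

text \<open>The search loops of \<open>hdrrm\<close> with ASMS replaced by an arbitrary
  \<open>Q\<close> and the size test by \<open>ok\<close>, so that they can be analysed apart from
  greedy covers.\<close>

definition doubling_bisection :: "('a \<Rightarrow> bool) \<Rightarrow> (nat \<Rightarrow> 'a) \<Rightarrow> nat \<Rightarrow> 'a option" where
  "doubling_bisection ok Q n =
     (let (k, R) =
         while (\<lambda>(k, R). k \<le> n \<and> R = None)
           (\<lambda>(k, R). if ok (Q k) then (k, Some (Q k)) else (2 * k, None))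
           (1, None);
       (low, high, R) =
         while (\<lambda>(low, high, R). low < high)
           (\<lambda>(low, high, R). let k = (low + high) div 2
             in if ok (Q k) then (low, k, Some (Q k)) else (k + 1, high, R))
           (k div 2 + 1, k, R)
   in R)"

text \<open>Below \<open>ks\<close> the test may succeed and fail in any pattern. A failure at
  \<open>k\<close> still gives \<open>k < ks\<close>, so \<open>low\<close> never passes
  \<open>ks\<close>, and the final \<open>high = low\<close> is at most \<open>ks\<close>.\<close>

lemma doubling_bisection_Some:
  fixes Q :: "nat \<Rightarrow> 'a"
  assumes ok: "\<And>k. k \<ge> ks \<Longrightarrow> ok (Q k)" and ks: "1 \<le> ks" "ks \<le> n"
  shows "\<exists>k\<ge>1. k \<le> ks \<and> ok (Q k) \<and>
     doubling_bisection ok Q n = Some (Q k)"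
proof -
  \<comment> \<open>After a failure, \<open>k div 2\<close> is the threshold that failed last, hence
    below \<open>ks\<close>; for \<open>k = 1\<close> the bound reads
    \<open>1 \<le> ks\<close>.\<close>
  define Inv1 where "Inv1 = (\<lambda>(k::nat, R). k \<ge> 1 \<and> k div 2 + 1 \<le> ks \<and>
     (\<forall>x. R = Some x \<longrightarrow> x = Q k \<and> ok x))"
  define b1 where "b1 = (\<lambda>(k::nat, R :: 'a option). k \<le> n \<and> R = None)"
  define c1 where "c1 = (\<lambda>(k, R :: 'a option). if ok (Q k) then (k, Some (Q k)) else (2 * k, None))"
  obtain k R where kR: "while b1 c1 (1, None) = (k, R)" by fastforce
  have "Inv1 (k, R) \<and> \<not> b1 (k, R)"
    unfolding kR[symmetric]
  \<comment> \<open>\<open>Suc\<close> keeps the measure positive while \<open>R = None\<close>, so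
    that assigning \<open>R\<close> decreases it too.\<close>
  proof (rule while_rule[where P = Inv1 and
        r = "Wellfounded.measure (\<lambda>(k, R). if R = None then Suc (n + 1 - k) else 0)"])
    show "Inv1 (1, None)" using ks by (simp add: Inv1_def)
    show "Inv1 (c1 s)" if "Inv1 s" "b1 s" for s
    proof -
      obtain k Z where s: "s = (k, Z)" by fastforce
      have "k < ks" if "\<not> ok (Q k)"
        by (rule ccontr) (use ok[of k] that in simp)
      then show ?thesis using that by (cases "ok (Q k)") (simp_all add: s Inv1_def b1_def c1_def)
    qed
    show "(c1 s, s) \<in> Wellfounded.measure (\<lambda>(k, R). if R = None then Suc (n + 1 - k) else 0)"
      if "Inv1 s" "b1 s" for s
    proof -
      obtain k Z where s: "s = (k, Z)" by fastforce
      have "Z = None" "1 \<le> k" "k \<le> n" using that by (simp_all add: s Inv1_def b1_def)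
      moreover from this have "Suc n - 2 * k < Suc n - k" by linarith
      ultimately show ?thesis by (simp add: s c1_def)
    qed
  qed auto
  then have 1: "k \<ge> 1" "k div 2 + 1 \<le> ks" "\<And>x. R = Some x \<Longrightarrow> x = Q k \<and> ok x"
    "R = None \<Longrightarrow> ks < k"
    using ks by (simp_all add: Inv1_def b1_def)
  \<comment> \<open>The last clause covers a doubling phase that runs past \<open>n\<close> without
    success: while \<open>R\<close> is unassigned, \<open>high\<close> exceeds \<open>ks\<close>,
    which is impossible once \<open>low = high\<close> and \<open>low \<le> ks\<close>.\<close>
  define Inv2 where "Inv2 = (\<lambda>(low::nat, high::nat, R). 1 \<le> low \<and> low \<le> ks \<and> low \<le> high \<and>
     (\<forall>x. R = Some x \<longrightarrow> x = Q high \<and> ok x) \<and> (R = None \<longrightarrow> ks < high))"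
  define b2 where "b2 = (\<lambda>(low::nat, high::nat, R :: 'a option). low < high)"
  define c2 where "c2 = (\<lambda>(low, high, R). let k = (low + high) div 2
                in if ok (Q k) then (low, k, Some (Q k)) else (k + 1, high, R))"
  obtain low high R' where 2: "while b2 c2 (k div 2 + 1, k, R) = (low, high, R')"
    by (metis prod.exhaust)
  have "Inv2 (low, high, R') \<and> \<not> b2 (low, high, R')"
    unfolding 2[symmetric]
  proof (rule while_rule[where P = Inv2 and r = "Wellfounded.measure (\<lambda>(low, high, R). high - low)"])
    show "Inv2 (k div 2 + 1, k, R)" using 1 by (simp add: Inv2_def)
    show "Inv2 (c2 s)" if "Inv2 s" "b2 s" for s
    proof -
      obtain l h Z where s: "s = (l, h, Z)" by (metis prod.exhaust)
      have "(l + h) div 2 < ks" if "\<not> ok (Q ((l + h) div 2))"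
        by (rule ccontr) (use ok[of "(l + h) div 2"] that in simp)
      then show ?thesis using that
        by (cases "ok (Q ((l + h) div 2))") (simp_all add: s Inv2_def b2_def c2_def Let_def)
    qed
    show "(c2 s, s) \<in> Wellfounded.measure (\<lambda>(low, high, R). high - low)" if "Inv2 s" "b2 s" for s
    proof -
      obtain l h Z where s: "s = (l, h, Z)" by (metis prod.exhaust)
      have "l < h" using that by (simp add: s b2_def)
      then have "(l + h) div 2 - l < h - l" "h - Suc ((l + h) div 2) < h - l" by linarith+
      then show ?thesis by (simp add: s c2_def Let_def)
    qed
  qed auto
  then have inv: "1 \<le> low" "low \<le> ks" "low = high" "\<And>x. R' = Some x \<Longrightarrow> x = Q high \<and> ok x"
    "R' = None \<Longrightarrow> ks < high"
    by (simp_all add: Inv2_def b2_def)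
  then obtain x where x: "R' = Some x" by (cases R') auto
  with inv inv(4)[OF x] have "high \<ge> 1" "high \<le> ks" "ok (Q high)" "R' = Some (Q high)" by simp_all
  then show ?thesis
    unfolding doubling_bisection_def b1_def[symmetric] c1_def[symmetric] b2_def[symmetric] c2_def[symmetric]
    by (intro exI[of _ high] conjI) (simp_all only: kR 2 Let_def prod.case)
qed

text \<open>Nothing is assumed about \<open>ok\<close>, so this applies to every sample, including
  the exceptional ones on which the size condition fails. It is needed to describe the success event
  on the whole sample space.\<close>

lemma doubling_bisection_range:
  fixes Q :: "nat \<Rightarrow> 'a"
  assumes "doubling_bisection ok Q n = Some x"
  shows "\<exists>k\<ge>1. x = Q k"
proof -
  define Inv1 where "Inv1 = (\<lambda>(k::nat, R). k \<ge> 1 \<and> (\<forall>x. R = Some x \<longrightarrow> (\<exists>k\<ge>1. x = Q k)))"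
  define b1 where "b1 = (\<lambda>(k::nat, R :: 'a option). k \<le> n \<and> R = None)"
  define c1 where "c1 = (\<lambda>(k, R :: 'a option). if ok (Q k) then (k, Some (Q k)) else (2 * k, None))"
  obtain k R where kR: "while b1 c1 (1, None) = (k, R)" by fastforce
  have 1: "Inv1 (k, R)"
    unfolding kR[symmetric]
  proof (rule while_rule[where P = Inv1 and
        r = "Wellfounded.measure (\<lambda>(k, R). if R = None then Suc (n + 1 - k) else 0)"])
    show "Inv1 (1, None)" by (simp add: Inv1_def)
    show "Inv1 (c1 s)" if "Inv1 s" "b1 s" for s
    proof -
      obtain k Z where s: "s = (k, Z)" by fastforce
      have "k \<ge> 1" using that by (simp add: s Inv1_def)
      then show ?thesis by (cases "ok (Q k)") (auto simp: s Inv1_def c1_def)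
    qed
    show "(c1 s, s) \<in> Wellfounded.measure (\<lambda>(k, R). if R = None then Suc (n + 1 - k) else 0)"
      if "Inv1 s" "b1 s" for s
      using that by (auto simp: Inv1_def b1_def c1_def)
  qed auto
  define Inv2 where "Inv2 = (\<lambda>(low::nat, high::nat, R). 1 \<le> low \<and>
     (\<forall>x. R = Some x \<longrightarrow> (\<exists>k\<ge>1. x = Q k)))"
  define b2 where "b2 = (\<lambda>(low::nat, high::nat, R :: 'a option). low < high)"
  define c2 where "c2 = (\<lambda>(low, high, R). let k = (low + high) div 2
                in if ok (Q k) then (low, k, Some (Q k)) else (k + 1, high, R))"
  obtain low high R' where 2: "while b2 c2 (k div 2 + 1, k, R) = (low, high, R')"
    by (metis prod.exhaust)
  have "Inv2 (low, high, R')"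
    unfolding 2[symmetric]
  proof (rule while_rule[where P = Inv2 and r = "Wellfounded.measure (\<lambda>(low, high, R). high - low)"])
    show "Inv2 (k div 2 + 1, k, R)" using 1 by (auto simp: Inv1_def Inv2_def)
    show "Inv2 (c2 s)" if "Inv2 s" "b2 s" for s
    proof -
      obtain l h Z where s: "s = (l, h, Z)" by (metis prod.exhaust)
      have "(l + h) div 2 \<ge> 1" using that by (auto simp: s Inv2_def b2_def)
      then show ?thesis using that by (auto simp: s Inv2_def b2_def c2_def Let_def)
    qed
    show "(c2 s, s) \<in> Wellfounded.measure (\<lambda>(low, high, R). high - low)" if "Inv2 s" "b2 s" for s
      using that by (auto simp: Inv2_def b2_def c2_def Let_def)
  qed auto
  moreover have "R' = Some x"
    using assms
    unfolding doubling_bisection_def b1_def[symmetric] c1_def[symmetric] b2_def[symmetric] c2_def[symmetric]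
    using kR 2 by auto
  ultimately show ?thesis by (auto simp: Inv2_def)
qed

section \<open>Ranks and utilities\<close>

lemma set_rank_le_iff:
  assumes "finite D" "S \<subseteq> D" "S \<noteq> {}"
  shows "set_rank D u S \<le> k \<longleftrightarrow> (\<exists>t\<in>S. tuple_rank D u t \<le> k)"
  using assms finite_subset[OF assms(2,1)] by (auto simp: set_rank_def Min_le_iff)

lemma tuple_rank_le_card:
  assumes "finite D" "t \<in> D"
  shows "tuple_rank D u t \<le> card D"
proof -
  have "{t' \<in> D. u \<bullet> t' > u \<bullet> t} \<subset> D" using assms(2) by auto
  then have "card {t' \<in> D. u \<bullet> t' > u \<bullet> t} < card D" using assms(1) by (rule psubset_card_mono[rotated])
  then show ?thesis by (simp add: tuple_rank_def)
qed

lemma exists_top_tuple: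
  assumes "finite D" "D \<noteq> {}"
  obtains t where "t \<in> D" "tuple_rank D u t = 1"
proof -
  have "Max ((\<bullet>) u ` D) \<in> (\<bullet>) u ` D" using assms by (intro Max_in) auto
  then obtain t where t: "t \<in> D" "u \<bullet> t = Max ((\<bullet>) u ` D)" by auto
  have "{t' \<in> D. u \<bullet> t' > u \<bullet> t} = {}"
    using assms(1) unfolding t(2) by (auto simp: not_less)
  then have "tuple_rank D u t = 1" by (simp only: tuple_rank_def card.empty)
  with t(1) show ?thesis by (rule that)
qed

lemma set_rank_ge_1:
  assumes "finite D" "S \<subseteq> D" "S \<noteq> {}"
  shows "1 \<le> set_rank D u S"
proof -
  have "\<not> set_rank D u S \<le> 0"
    unfolding set_rank_le_iff[OF assms] by (auto simp: tuple_rank_def)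
  then show ?thesis by simp
qed

lemma set_rank_le_card:
  assumes "finite D" "S \<subseteq> D" "S \<noteq> {}"
  shows "set_rank D u S \<le> card D"
  using assms tuple_rank_le_card[OF assms(1)] unfolding set_rank_le_iff[OF assms] by blast

lemma max_rank_le_iff:
  assumes "finite D" "S \<subseteq> D" "S \<noteq> {}" "V \<noteq> {}"
  shows "max_rank D V S \<le> k \<longleftrightarrow> (\<forall>u\<in>V. set_rank D u S \<le> k)"
proof -
  have "finite ((\<lambda>u. set_rank D u S) ` V)"
    by (rule finite_subset[of _ "{..card D}"]) (use set_rank_le_card[OF assms(1-3)] in auto)
  then show ?thesis using assms(4) by (auto simp: max_rank_def)
qed

lemma max_rank_bounds:
  assumes "finite D" "S \<subseteq> D" "S \<noteq> {}" "V \<noteq> {}"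
  shows "1 \<le> max_rank D V S" "max_rank D V S \<le> card D"
proof -
  obtain u where "u \<in> V" using assms(4) by blast
  then have "1 \<le> set_rank D u S" "set_rank D u S \<le> max_rank D V S"
    using set_rank_ge_1[OF assms(1-3)] max_rank_le_iff[OF assms, of "max_rank D V S"] by auto
  then show "1 \<le> max_rank D V S" by simp
  show "max_rank D V S \<le> card D"
    unfolding max_rank_le_iff[OF assms] using set_rank_le_card[OF assms(1-3)] by blast
qed

lemma axis_in_nonneg_sphere: "axis i 1 \<in> nonneg_sphere"
  by (auto simp: nonneg_sphere_def axis_def norm_axis_1[unfolded axis_def])

lemma opt_rank_attained:
  fixes D :: "(real^'n) set"
  assumes "finite D" "D \<noteq> {}" "1 \<le> s"
  obtains S where "S \<subseteq> D" "S \<noteq> {}" "real (card S) \<le> s"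
    "max_rank D nonneg_sphere S = opt_rank D s"
proof -
  let ?A = "{max_rank D nonneg_sphere S | S. S \<subseteq> D \<and> S \<noteq> {} \<and> real (card S) \<le> s}"
  have "?A \<subseteq> max_rank D nonneg_sphere ` Pow D" by auto
  then have "finite ?A" using assms(1) by (meson finite_Pow_iff finite_imageI finite_subset)
  moreover obtain t where "t \<in> D" using assms(2) by blast
  then have "max_rank D nonneg_sphere {t} \<in> ?A"
    using assms(3) by (intro CollectI exI[of _ "{t}"]) auto
  ultimately have "Min ?A \<in> ?A" by (intro Min_in) auto
  then have "opt_rank D s \<in> ?A" unfolding opt_rank_def .
  then obtain S where "opt_rank D s = max_rank D nonneg_sphere S" "S \<subseteq> D" "S \<noteq> {}" "real (card S) \<le> s"
    unfolding mem_Collect_eq by (elim exE conjE)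
  then show ?thesis by (intro that[of S]) simp_all
qed

section \<open>The k-th highest utility under a change of direction\<close>

text \<open>In the decreasing list of utilities the first \<open>k\<close> entries are at least the
  entry at index \<open>k - 1\<close>. Passing to multisets turns this into a count of tuples, the
  only property of \<open>kth_utility\<close> used later.\<close>

lemma kth_utility_card_ge:
  assumes "finite D" "1 \<le> k" "k \<le> card D"
  shows "k \<le> card {t \<in> D. kth_utility k u D \<le> u \<bullet> t}"
proof -
  define M where "M = {#u \<bullet> t. t \<in># mset_set D#}"
  define xs where "xs = rev (sorted_list_of_multiset M)"
  define x where "x = kth_utility k u D"
  have mset: "mset xs = M" by (simp add: xs_def)
  have len: "length xs = card D" by (metis M_def mset size_image_mset size_mset size_mset_set)
  have sorted: "sorted_wrt (\<ge>) xs"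
    by (simp add: xs_def sorted_wrt_rev)
  have x: "x = xs ! (k - 1)"
    by (simp add: x_def kth_utility_def xs_def M_def)
  have "y \<ge> x" if y: "y \<in> set (take k xs)" for y
  proof -
    obtain i where i: "i < k" "i < length xs" "y = xs ! i"
      using y by (auto simp: in_set_conv_nth)
    show ?thesis
    proof (cases "i = k - 1")
      case False
      then show ?thesis
        using sorted_wrt_nth_less[OF sorted, of i "k - 1"] i assms len x by simp
    qed (use i x in simp)
  qed
  then have "filter (\<lambda>y. x \<le> y) (take k xs) = take k xs" by (simp add: filter_id_conv)
  then have "k \<le> length (filter (\<lambda>y. x \<le> y) (take k xs @ drop k xs))"
    unfolding filter_append length_append using assms len by simp
  also have "\<dots> = size (filter_mset (\<lambda>y. x \<le> y) M)"
    by (metis append_take_drop_id mset mset_filter size_mset)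
  also have "\<dots> = card {t \<in> D. x \<le> u \<bullet> t}"
    using assms(1) by (simp add: M_def filter_mset_image_mset)
  finally show ?thesis by (simp add: x_def)
qed

text \<open>Pigeonhole: at least \<open>k\<close> tuples reach the k-th utility for
  \<open>u\<close>, while at most \<open>k - 1\<close> tuples beat \<open>t\<close> for
  \<open>v\<close>. So one of the former does not beat \<open>t\<close> for \<open>v\<close>, and
  passing between \<open>u\<close> and \<open>v\<close> costs \<open>\<eta>\<close> for each of the
  two tuples.\<close>

lemma kth_utility_le_of_rank:
  assumes "finite D" "1 \<le> k" "k \<le> card D" "tuple_rank D v t \<le> k"
    and close: "\<And>t. t \<in> D \<Longrightarrow> \<bar>u \<bullet> t - v \<bullet> t\<bar> \<le> \<eta>" and t: "t \<in> D"
  shows "kth_utility k u D - 2 * \<eta> \<le> u \<bullet> t"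
proof -
  have "\<exists>t'\<in>D. kth_utility k u D \<le> u \<bullet> t' \<and> v \<bullet> t' \<le> v \<bullet> t"
  proof (rule ccontr)
    assume "\<not> ?thesis"
    then have "{t' \<in> D. kth_utility k u D \<le> u \<bullet> t'} \<subseteq> {t' \<in> D. v \<bullet> t' > v \<bullet> t}"
      by (auto simp: not_le)
    then have "card {t' \<in> D. kth_utility k u D \<le> u \<bullet> t'} \<le> card {t' \<in> D. v \<bullet> t' > v \<bullet> t}"
      using assms(1) by (intro card_mono) auto
    then show False
      using kth_utility_card_ge[OF assms(1-3), of u] assms(4) by (simp add: tuple_rank_def)
  qed
  then obtain t' where "t' \<in> D" "kth_utility k u D \<le> u \<bullet> t'" "v \<bullet> t' \<le> v \<bullet> t" by blast
  with close[of t] close[of t'] t show ?thesis by linarith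
qed

text \<open>The boundary tuple \<open>b i\<close> has utility at least \<open>u $ i\<close>, hence
  at least its square, and the squares add up to 1. Summing over \<open>i\<close> avoids singling
  out a largest coordinate, at the price of \<open>1 / d\<close> in place of
  \<open>1 / sqrt d\<close>.\<close>

lemma max_utility_boundary_ge:
  fixes D :: "(real^'n) set"
  assumes D: "is_dataset D" and b: "boundary_tuples D b" and R: "finite R" "range b \<subseteq> R"
    and u: "u \<in> nonneg_sphere"
  shows "1 / real CARD('n) \<le> max_utility u R"
proof -
  have u0: "0 \<le> u $ i" for i using u by (simp add: nonneg_sphere_def)
  have u1: "u $ i \<le> 1" for i
    using u component_le_norm_cart[of u i] by (simp add: nonneg_sphere_def)
  have "1 = (norm u)\<^sup>2" using u by (simp add: nonneg_sphere_def)
  also have "\<dots> = (\<Sum>i\<in>UNIV. u $ i * u $ i)"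
    by (simp add: power2_norm_eq_inner inner_vec_def)
  also have "\<dots> \<le> (\<Sum>i\<in>(UNIV :: 'n set). max_utility u R)"
  proof (rule sum_mono)
    fix i
    have nonneg: "0 \<le> b i $ j" for j using D b by (auto simp: is_dataset_def boundary_tuples_def)
    have "u $ i * u $ i \<le> u $ i" using u0 u1 by (simp add: mult_left_le)
    also have "\<dots> = u $ i * b i $ i" using b by (simp add: boundary_tuples_def)
    also have "\<dots> \<le> (\<Sum>j\<in>UNIV. u $ j * b i $ j)"
      using u0 nonneg by (intro member_le_sum) auto
    also have "\<dots> = u \<bullet> b i" by (simp add: inner_vec_def)
    also have "\<dots> \<le> max_utility u R"
      unfolding max_utility_def using R by (intro Max_ge) auto
    finally show "u $ i * u $ i \<le> max_utility u R" .
  qed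
  finally show ?thesis by (simp add: field_simps)
qed

text \<open>The tolerance \<open>\<epsilon> / (2 * d^2)\<close> per coordinate becomes
  \<open>\<epsilon> / (2 * d)\<close> per utility, as tuples have \<open>d\<close> entries in
  [0, 1], and then an additive loss \<open>\<epsilon> / d\<close>, which the lower bound
  \<open>1 / d\<close> makes relative.\<close>

lemma approximation_guarantee:
  fixes D :: "(real^'n) set"
  assumes D: "is_dataset D" and b: "boundary_tuples D b" and R: "R \<subseteq> D" "range b \<subseteq> R"
    and k: "1 \<le> k" "k \<le> card D"
    and u: "u \<in> nonneg_sphere" and \<epsilon>: "0 < \<epsilon>" "\<epsilon> < 1"
    and v: "set_rank D v R \<le> k"
    and close: "\<And>i. \<bar>u $ i - v $ i\<bar> \<le> \<epsilon> / (2 * real CARD('n) ^ 2)"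
  shows "(1 - \<epsilon>) * kth_utility k u D \<le> max_utility u R"
proof -
  define d where "d = real CARD('n)"
  have d: "d > 0" by (simp add: d_def)
  have finD: "finite D" using D by (simp add: is_dataset_def)
  then have finR: "finite R" using R(1) finite_subset by blast
  have R0: "R \<noteq> {}" using R(2) by auto
  obtain t where t: "t \<in> R" "tuple_rank D v t \<le> k"
    using v unfolding set_rank_le_iff[OF finD R(1) R0] by blast
  have "\<bar>u \<bullet> t - v \<bullet> t\<bar> \<le> \<epsilon> / (2 * d)" if "t \<in> D" for t
  proof -
    have t01: "0 \<le> t $ i \<and> t $ i \<le> 1" for i using D that by (simp add: is_dataset_def)
    have "\<bar>u \<bullet> t - v \<bullet> t\<bar> = \<bar>\<Sum>i\<in>UNIV. (u $ i - v $ i) * t $ i\<bar>"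
      by (simp add: inner_vec_def sum_subtractf left_diff_distrib)
    also have "\<dots> \<le> (\<Sum>i\<in>UNIV. \<bar>(u $ i - v $ i) * t $ i\<bar>)" by (rule sum_abs)
    also have "\<dots> \<le> (\<Sum>i\<in>(UNIV::'n set). \<epsilon> / (2 * d ^ 2))"
    proof (rule sum_mono)
      fix i
      have "\<bar>(u $ i - v $ i) * t $ i\<bar> \<le> \<bar>u $ i - v $ i\<bar> * 1"
        unfolding abs_mult using t01[of i] by (intro mult_left_mono) auto
      then show "\<bar>(u $ i - v $ i) * t $ i\<bar> \<le> \<epsilon> / (2 * d ^ 2)"
        using close[of i] by (simp add: d_def)
    qed
    also have "\<dots> = \<epsilon> / (2 * d)" using d by (simp add: d_def power2_eq_square)
    finally show ?thesis .
  qed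
  then have "kth_utility k u D - 2 * (\<epsilon> / (2 * d)) \<le> u \<bullet> t"
    using t R(1) by (intro kth_utility_le_of_rank[OF finD k t(2)]) auto
  also have "u \<bullet> t \<le> max_utility u R"
    unfolding max_utility_def using finR t by (intro Max_ge) auto
  finally have 1: "kth_utility k u D \<le> max_utility u R + \<epsilon> * (1 / d)" by simp
  have 2: "1 / d \<le> max_utility u R"
    unfolding d_def by (rule max_utility_boundary_ge[OF D b finR R(2) u])
  show ?thesis
  \<comment> \<open>If this fails, the k-th utility itself exceeds \<open>1 / d\<close>, so the loss
    \<open>\<epsilon> / d\<close> is at most \<open>\<epsilon>\<close> times it.\<close>
  proof (cases "kth_utility k u D \<le> max_utility u R")
    case True
    have "(1 - \<epsilon>) * kth_utility k u D \<le> (1 - \<epsilon>) * max_utility u R"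
      using True \<epsilon> by (intro mult_left_mono) auto
    also have "\<dots> \<le> 1 * max_utility u R"
      using \<epsilon> 2 d by (intro mult_right_mono) (auto intro: order.trans[of 0 "1/d"])
    finally show ?thesis by simp
  next
    case False
    then have "\<epsilon> * (1 / d) \<le> \<epsilon> * kth_utility k u D"
      using 2 \<epsilon> by (intro mult_left_mono) auto
    then show ?thesis using 1 by (simp add: left_diff_distrib)
  qed
qed

section \<open>The polar grid\<close>

lemma coord_no_bij: "bij_betw coord_no (UNIV :: 'n::{finite,linorder} set) {1..CARD('n)}"
proof -
  have "coord_no i < coord_no j" if "i < j" for i j :: 'n
    unfolding coord_no_def
  proof (rule psubset_card_mono)
    have "j \<notin> {k. k \<le> i}" "j \<in> {k. k \<le> j}" "{k. k \<le> i} \<subseteq> {k. k \<le> j}"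
      using that by auto
    then show "{k. k \<le> i} \<subset> {k. k \<le> j}" by blast
  qed simp
  then have inj: "inj (coord_no :: 'n \<Rightarrow> nat)"
    by (metis injI less_irrefl linorder_neqE)
  have sub: "range (coord_no :: 'n \<Rightarrow> nat) \<subseteq> {1..CARD('n)}"
  proof safe
    fix i :: 'n
    have "coord_no i \<ge> 1" unfolding coord_no_def by (simp add: Suc_le_eq card_gt_0_iff) auto
    moreover have "coord_no i \<le> CARD('n)" unfolding coord_no_def by (intro card_mono) auto
    ultimately show "coord_no i \<in> {1..CARD('n)}" by simp
  qed
  have "range (coord_no :: 'n \<Rightarrow> nat) = {1..CARD('n)}"
    by (rule card_subset_eq[OF _ sub]) (use inj in \<open>auto simp: card_image\<close>)
  with inj show ?thesis by (simp add: bij_betw_def)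
qed

lemma coord_no_bounds:
  fixes i :: "'n::{finite,linorder}"
  shows "1 \<le> coord_no i" "coord_no i \<le> CARD('n)"
  using bij_betwE[OF coord_no_bij] by fastforce+

lemma polar_map_cong:
  fixes \<theta> :: "nat \<Rightarrow> real"
  assumes "\<And>j. j \<in> {1..CARD('n::{finite,linorder}) - 1} \<Longrightarrow> \<theta> j = \<theta>' j"
  shows "(polar_map \<theta> :: real^('n::_)) = polar_map \<theta>'"
proof -
  have "(\<Prod>j = coord_no i..CARD('n) - 1. sin (\<theta> j)) * cos ((\<theta>(0 := 0)) (coord_no i - 1)) =
    (\<Prod>j = coord_no i..CARD('n) - 1. sin (\<theta>' j)) * cos ((\<theta>'(0 := 0)) (coord_no i - 1))" for i :: 'n
  proof -
    have "(\<Prod>j = coord_no i..CARD('n) - 1. sin (\<theta> j)) = (\<Prod>j = coord_no i..CARD('n) - 1. sin (\<theta>' j))"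
      using coord_no_bounds[of i] assms by (intro prod.cong) auto
    moreover have "(\<theta>(0 := 0)) (coord_no i - 1) = (\<theta>'(0 := 0)) (coord_no i - 1)"
    proof (cases "coord_no i = 1")
      case False
      then have "coord_no i - 1 \<in> {1..CARD('n) - 1}"
        using coord_no_bounds[of i] by auto
      from assms[OF this] show ?thesis by simp
    qed simp
    ultimately show ?thesis by simp
  qed
  then show ?thesis unfolding polar_map_def by simp
qed

text \<open>The comprehension in \<open>polar_grid\<close> ranges over infinitely many
  \<open>z\<close>, unconstrained off the indices \<open>1, ..., d - 1\<close>. By
  \<open>polar_map_cong\<close> restricting \<open>z\<close> to these indices changes nothing, and
  the restrictions form a finite product.\<close>

lemma polar_grid_finite_card:
  "finite (polar_grid \<gamma> :: (real^('n::{finite,linorder})) set) \<and>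
   card (polar_grid \<gamma> :: (real^('n::_)) set) \<le> (\<gamma> + 1) ^ (CARD('n) - 1)"
proof -
  let ?F = "PiE {1..CARD('n) - 1} (\<lambda>_. {0..\<gamma>})"
  let ?p = "\<lambda>z. polar_map (\<lambda>j. real (z j) * pi / (2 * real \<gamma>)) :: real^('n::_)"
  have "polar_grid \<gamma> \<subseteq> ?p ` ?F"
  proof
    fix x :: "real^('n::_)" assume "x \<in> polar_grid \<gamma>"
    then obtain z where z: "x = ?p z" "\<forall>j\<in>{1..CARD('n) - 1}. z j \<in> {0..\<gamma>}"
      unfolding polar_grid_def by auto
    have "x = ?p (restrict z {1..CARD('n) - 1})"
      unfolding z(1) by (rule polar_map_cong) auto
    moreover have "restrict z {1..CARD('n) - 1} \<in> ?F" using z(2) by auto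
    ultimately show "x \<in> ?p ` ?F" by blast
  qed
  moreover have fin: "finite ?F" by (intro finite_PiE) auto
  moreover have "card ?F = (\<gamma> + 1) ^ (CARD('n) - 1)" by (simp add: card_PiE)
  then have "card (?p ` ?F) \<le> (\<gamma> + 1) ^ (CARD('n) - 1)"
    using card_image_le[OF fin, of ?p] by simp
  moreover have "finite (?p ` ?F)" using fin by blast
  ultimately show ?thesis
    by (meson card_mono finite_subset le_trans)
qed

lemma polar_map_in_sphere:
  assumes "\<And>j. j \<in> {1..CARD('n::{finite,linorder}) - 1} \<Longrightarrow> 0 \<le> \<theta> j \<and> \<theta> j \<le> pi / 2"
  shows "(polar_map \<theta> :: real^('n::_)) \<in> nonneg_sphere"
proof -
  define d where "d = CARD('n)"
  define c where "c = (\<lambda>i. (\<Prod>j = i..d - 1. sin (\<theta> j)) * cos ((\<theta>(0 := 0)) (i - 1)))"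
  have d: "d \<ge> 1" by (simp add: d_def Suc_le_eq)
  have nth: "(polar_map \<theta> :: real^('n::_)) $ i = c (coord_no i)" for i
    by (simp add: polar_map_def c_def d_def)
  have "0 \<le> (polar_map \<theta> :: real^('n::_)) $ i" for i
  proof -
    have "0 \<le> (\<Prod>j = coord_no i..d - 1. sin (\<theta> j))"
    proof (rule prod_nonneg)
      fix j assume "j \<in> {coord_no i..d - 1}"
      then have "0 \<le> \<theta> j \<and> \<theta> j \<le> pi / 2"
        using assms coord_no_bounds(1)[of i] by (auto simp: d_def)
      then show "0 \<le> sin (\<theta> j)" using pi_ge_zero by (intro sin_ge_zero) linarith+
    qed
    moreover have "0 \<le> cos ((\<theta>(0 := 0)) (coord_no i - 1))"
    proof (cases "coord_no i = 1")
      case False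
      then have "coord_no i - 1 \<in> {1..CARD('n) - 1}"
        using coord_no_bounds[of i] by auto
      from assms[OF this] show ?thesis
        using False coord_no_bounds(1)[of i] pi_ge_zero by (intro cos_ge_zero) auto
    qed simp
    ultimately show ?thesis by (simp add: nth c_def)
  qed
  moreover have "norm (polar_map \<theta> :: real^('n::_)) = 1"
  proof -
    \<comment> \<open>The squares telescope through the Pythagorean identity. The base case relies
      on the angle with index 0 being set to 0, and at \<open>k = d\<close> the product is
      empty.\<close>
    have sum: "k \<le> d \<Longrightarrow> (\<Sum>i = 1..k. (c i)\<^sup>2) = (\<Prod>j = k..d - 1. (sin (\<theta> j))\<^sup>2)" if "1 \<le> k" for k
      using that
    proof (induction k rule: dec_induct)
      case base
      show ?case by (simp add: c_def power_mult_distrib prod_power_distrib)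
    next
      case (step k)
      have "(\<Sum>i = 1..Suc k. (c i)\<^sup>2) = (\<Prod>j = k..d - 1. (sin (\<theta> j))\<^sup>2) + (c (Suc k))\<^sup>2"
        using step by simp
      also have "(c (Suc k))\<^sup>2 = (\<Prod>j = Suc k..d - 1. (sin (\<theta> j))\<^sup>2) * (cos (\<theta> k))\<^sup>2"
        using step by (simp add: c_def power_mult_distrib prod_power_distrib)
      also have "(\<Prod>j = k..d - 1. (sin (\<theta> j))\<^sup>2) = (sin (\<theta> k))\<^sup>2 * (\<Prod>j = Suc k..d - 1. (sin (\<theta> j))\<^sup>2)"
        using step by (intro prod.atLeast_Suc_atMost) auto
      also have "\<dots> + (\<Prod>j = Suc k..d - 1. (sin (\<theta> j))\<^sup>2) * (cos (\<theta> k))\<^sup>2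
        = (\<Prod>j = Suc k..d - 1. (sin (\<theta> j))\<^sup>2) * ((sin (\<theta> k))\<^sup>2 + (cos (\<theta> k))\<^sup>2)"
        by (simp only: distrib_left) (simp only: mult.commute)
      also have "\<dots> = (\<Prod>j = Suc k..d - 1. (sin (\<theta> j))\<^sup>2)"
        by (simp only: sin_cos_squared_add mult_1_right)
      finally show ?case .
    qed
    have "(norm (polar_map \<theta> :: real^('n::_)))\<^sup>2 = (\<Sum>i\<in>(UNIV::'n set). (c (coord_no i))\<^sup>2)"
      by (subst power2_norm_eq_inner) (simp add: inner_vec_def nth power2_eq_square)
    also have "\<dots> = (\<Sum>i = 1..d. (c i)\<^sup>2)"
      unfolding d_def by (rule sum.reindex_bij_betw[OF coord_no_bij])
    also have "\<dots> = 1" using sum[OF d] d by simp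
    finally show ?thesis
      using norm_ge_zero[of "polar_map \<theta> :: real^('n::_)"] by (auto simp: power2_eq_1_iff)
  qed
  ultimately show ?thesis by (simp add: nonneg_sphere_def)
qed

lemma polar_grid_subset_sphere:
  assumes "\<gamma> \<ge> 1"
  shows "(polar_grid \<gamma> :: (real^('n::{finite,linorder})) set) \<subseteq> nonneg_sphere"
proof
  fix x :: "real^('n::_)" assume "x \<in> polar_grid \<gamma>"
  then obtain z where z: "x = polar_map (\<lambda>j. real (z j) * pi / (2 * real \<gamma>))"
    "\<forall>j\<in>{1..CARD('n) - 1}. z j \<in> {0..\<gamma>}"
    unfolding polar_grid_def by auto
  show "x \<in> nonneg_sphere" unfolding z(1)
  proof (rule polar_map_in_sphere)
    fix j assume "j \<in> {1..CARD('n) - 1}"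
    then have "real (z j) \<le> real \<gamma>" using z(2) by auto
    then have "real (z j) / real \<gamma> \<le> 1" using assms by simp
    then have "real (z j) / real \<gamma> * (pi / 2) \<le> 1 * (pi / 2)"
      by (intro mult_right_mono) auto
    then show "0 \<le> real (z j) * pi / (2 * real \<gamma>) \<and> real (z j) * pi / (2 * real \<gamma>) \<le> pi / 2"
      by (simp add: field_simps)
  qed
qed

text \<open>The angles come from the partial norms: \<open>cos (\<theta> j)\<close> is the ratio of the coordinate
  number \<open>j + 1\<close> to the norm of the first \<open>j + 1\<close> coordinates.\<close>

lemma polar_map_surj:
  fixes u :: "real^('n::{finite,linorder})"
  assumes u: "u \<in> nonneg_sphere"
  obtains \<theta> where "\<And>j. 0 \<le> \<theta> j \<and> \<theta> j \<le> pi / 2" "polar_map \<theta> = u"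
proof -
  define d where "d = CARD('n)"
  have d: "d \<ge> 1" by (simp add: d_def Suc_le_eq)
  define x where "x = (\<lambda>k. if k \<in> {1..d} then u $ (inv_into UNIV coord_no k) else 0)"
  have xu: "x (coord_no i) = u $ i" for i
    using coord_no_bounds[of i] inv_into_f_f[OF bij_betw_imp_inj_on[OF coord_no_bij], of i]
    by (simp add: x_def d_def)
  have x0: "0 \<le> x k" for k using u by (simp add: x_def nonneg_sphere_def)
  define r where "r = (\<lambda>k. sqrt (\<Sum>i = 1..k. (x i)\<^sup>2))"
  define \<theta> where "\<theta> = (\<lambda>j. arccos (x (Suc j) / r (Suc j)))"
  have r0: "0 \<le> r k" for k by (simp add: r_def sum_nonneg)
  have r2: "(r k)\<^sup>2 = (\<Sum>i = 1..k. (x i)\<^sup>2)" for k by (simp add: r_def sum_nonneg)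
  have rSuc: "(r (Suc k))\<^sup>2 = (r k)\<^sup>2 + (x (Suc k))\<^sup>2" for k by (simp add: r2)
  have xr: "x (Suc k) \<le> r (Suc k)" for k
    by (rule power2_le_imp_le) (use rSuc[of k] r0 in auto)
  have ratio: "0 \<le> x (Suc k) / r (Suc k)" "x (Suc k) / r (Suc k) \<le> 1" for k
    using xr[of k] x0[of "Suc k"] r0[of "Suc k"] by (auto simp: divide_le_eq_1)
  \<comment> \<open>The product form survives \<open>r (Suc k) = 0\<close>: then
    \<open>x (Suc k)\<close> vanishes as well, whatever the angle is.\<close>
  have cos: "r (Suc k) * cos (\<theta> k) = x (Suc k)" for k
  proof -
    have "cos (\<theta> k) = x (Suc k) / r (Suc k)"
      unfolding \<theta>_def using ratio[of k] by (intro cos_arccos) auto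
    then show ?thesis using xr[of k] x0[of "Suc k"] by auto
  qed
  have range: "0 \<le> \<theta> j \<and> \<theta> j \<le> pi / 2" for j
    unfolding \<theta>_def using ratio[of j] by (intro conjI arccos_lbound arccos_le_pi2) auto
  have sin: "r (Suc k) * sin (\<theta> k) = r k" for k
  proof -
    have "sin (\<theta> k) \<ge> 0" using range[of k] pi_ge_zero by (intro sin_ge_zero) linarith+
    moreover have "(r (Suc k) * sin (\<theta> k))\<^sup>2 = (r (Suc k))\<^sup>2 - (r (Suc k) * cos (\<theta> k))\<^sup>2"
      by (simp add: power_mult_distrib sin_squared_eq algebra_simps)
    then have "(r (Suc k) * sin (\<theta> k))\<^sup>2 = (r k)\<^sup>2" by (simp add: cos rSuc)
    ultimately show ?thesis using r0 by (simp add: power2_eq_iff_nonneg)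
  qed
  have rd: "r d = 1"
  proof -
    have "(\<Sum>i = 1..d. (x i)\<^sup>2) = (\<Sum>i\<in>(UNIV::'n set). (x (coord_no i))\<^sup>2)"
      unfolding d_def by (rule sum.reindex_bij_betw[OF coord_no_bij, symmetric])
    also have "\<dots> = (norm u)\<^sup>2"
      by (subst power2_norm_eq_inner) (simp add: inner_vec_def xu power2_eq_square)
    finally show ?thesis using u by (simp add: r_def nonneg_sphere_def)
  qed
  \<comment> \<open>Downward induction from \<open>r d = 1\<close>: the factor
    \<open>sin (\<theta> k)\<close> turns the norm of the first \<open>k + 1\<close> coordinates
    into that of the first \<open>k\<close>.\<close>
  have prod: "(\<Prod>j = k..d - 1. sin (\<theta> j)) = r k" if "k \<le> d" for k
    using that
  proof (induction rule: inc_induct)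
    case base
    show ?case using d rd by simp
  next
    case (step k)
    have "(\<Prod>j = k..d - 1. sin (\<theta> j)) = sin (\<theta> k) * (\<Prod>j = Suc k..d - 1. sin (\<theta> j))"
      using step by (intro prod.atLeast_Suc_atMost) auto
    then show ?case using step.IH sin[of k] by (simp add: mult.commute)
  qed
  have "polar_map \<theta> = u"
  proof (rule iffD2[OF vec_eq_iff], rule allI)
    fix i :: 'n
    have "(polar_map \<theta> :: real^('n::_)) $ i = r (coord_no i) * cos ((\<theta>(0 := 0)) (coord_no i - 1))"
      using prod[of "coord_no i"] coord_no_bounds[of i] by (simp add: polar_map_def d_def)
    also have "\<dots> = x (coord_no i)"
    \<comment> \<open>For the first coordinate the cosine is 1 by the overridden angle, and
      \<open>r 1 = x 1\<close> because the coordinates are nonnegative.\<close>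
    proof (cases "coord_no i = 1")
      case True
      then show ?thesis using x0 by (simp add: r_def)
    next
      case False
      then show ?thesis using cos[of "coord_no i - 1"] coord_no_bounds(1)[of i] by simp
    qed
    finally show "(polar_map \<theta> :: real^('n::_)) $ i = u $ i" by (simp add: xu)
  qed
  with range that show ?thesis by blast
qed

section \<open>Lipschitz estimates for the polar map\<close>

lemma abs_sin_diff_le: "\<bar>sin x - sin y\<bar> \<le> \<bar>x - y\<bar>" for x y :: real
proof -
  have "\<bar>sin x - sin y\<bar> = 2 * \<bar>sin ((x - y) / 2)\<bar> * \<bar>cos ((x + y) / 2)\<bar>"
    by (simp add: sin_diff_sin abs_mult)
  also have "\<dots> \<le> 2 * \<bar>(x - y) / 2\<bar> * 1"
    by (intro mult_mono abs_sin_x_le_abs_x) auto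
  finally show ?thesis by simp
qed

lemma abs_cos_diff_le: "\<bar>cos x - cos y\<bar> \<le> \<bar>x - y\<bar>" for x y :: real
  using abs_sin_diff_le[of "pi / 2 - x" "pi / 2 - y"]
  by (simp add: sin_diff abs_minus_commute)

lemma abs_prod_diff_le:
  fixes f g :: "'a \<Rightarrow> real"
  assumes "finite A" "\<And>a. a \<in> A \<Longrightarrow> \<bar>f a\<bar> \<le> 1" "\<And>a. a \<in> A \<Longrightarrow> \<bar>g a\<bar> \<le> 1"
    "\<And>a. a \<in> A \<Longrightarrow> \<bar>f a - g a\<bar> \<le> e"
  shows "\<bar>prod f A - prod g A\<bar> \<le> real (card A) * e"
proof -
  have "norm (prod f A - prod g A) \<le> (\<Sum>a\<in>A. norm (f a - g a))"
    by (rule norm_prod_diff) (use assms in auto)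
  also have "\<dots> \<le> (\<Sum>a\<in>A. e)" using assms(4) by (intro sum_mono) auto
  finally show ?thesis by simp
qed

text \<open>Coordinate number \<open>k\<close> is a product of \<open>d - k\<close> sines and one
  cosine. All factors are bounded by 1 and 1-Lipschitz in their angle, so the error is at most
  \<open>d - k + 1\<close> times \<open>e\<close>.\<close>

lemma polar_map_close:
  assumes close: "\<And>j. j \<in> {1..CARD('n::{finite,linorder}) - 1} \<Longrightarrow> \<bar>\<theta> j - \<theta>' j\<bar> \<le> e" and e: "0 \<le> e"
  shows "\<bar>(polar_map \<theta> :: real^('n::_)) $ i - polar_map \<theta>' $ i\<bar> \<le> real CARD('n) * e"
proof -
  define k where "k = coord_no i"
  define d where "d = CARD('n)"
  have k: "1 \<le> k" "k \<le> d" using coord_no_bounds[of i] by (auto simp: k_def d_def)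
  define p where "p = (\<lambda>\<theta>. \<Prod>j = k..d - 1. sin (\<theta> j :: real))"
  define c where "c = (\<lambda>\<theta>. cos ((\<theta>(0 := 0)) (k - 1) :: real))"
  have p: "\<bar>p \<theta> - p \<theta>'\<bar> \<le> real (card {k..d - 1}) * e"
    unfolding p_def
  proof (rule abs_prod_diff_le)
    fix j assume "j \<in> {k..d - 1}"
    then have "\<bar>\<theta> j - \<theta>' j\<bar> \<le> e" using k by (intro close) (auto simp: d_def)
    then show "\<bar>sin (\<theta> j) - sin (\<theta>' j)\<bar> \<le> e" using abs_sin_diff_le order_trans by blast
  qed auto
  have c: "\<bar>c \<theta> - c \<theta>'\<bar> \<le> e"
  proof (cases "k = 1")
    case False
    then have "\<bar>\<theta> (k - 1) - \<theta>' (k - 1)\<bar> \<le> e" using k by (intro close) (auto simp: d_def)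
    then show ?thesis using False k abs_cos_diff_le[of "\<theta> (k - 1)" "\<theta>' (k - 1)"] by (simp add: c_def)
  qed (use e in \<open>simp add: c_def\<close>)
  have p1: "\<bar>p \<theta>'\<bar> \<le> 1"
    unfolding p_def abs_prod by (rule prod_le_1) auto
  have "\<bar>p \<theta> * c \<theta> - p \<theta>' * c \<theta>'\<bar> = \<bar>(p \<theta> - p \<theta>') * c \<theta> + p \<theta>' * (c \<theta> - c \<theta>')\<bar>"
    by (simp add: algebra_simps)
  also have "\<dots> \<le> \<bar>p \<theta> - p \<theta>'\<bar> * \<bar>c \<theta>\<bar> + \<bar>p \<theta>'\<bar> * \<bar>c \<theta> - c \<theta>'\<bar>"
    by (metis abs_mult abs_triangle_ineq)
  also have "\<dots> \<le> \<bar>p \<theta> - p \<theta>'\<bar> * 1 + 1 * \<bar>c \<theta> - c \<theta>'\<bar>"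
    using p1 by (intro add_mono mult_left_mono mult_right_mono) (auto simp: c_def)
  also have "\<dots> \<le> real (card {k..d - 1}) * e + e" using p c by simp
  also have "\<dots> = (real (d - k) + 1) * e" using k by (simp add: algebra_simps of_nat_diff)
  also have "\<dots> \<le> real d * e" using k e by (intro mult_right_mono) auto
  finally show ?thesis by (simp add: polar_map_def p_def c_def k_def d_def)
qed

text \<open>Surjectivity of the polar map reduces a net in the sphere to a net in the box of angles,
  where every angle is rounded down to a multiple of the mesh. The index stays at most
  \<open>\<gamma>\<close> because \<open>pi / 2\<close> is exactly \<open>\<gamma>\<close>
  meshes.\<close>

lemma polar_grid_net:
  fixes u :: "real^('n::{finite,linorder})"
  assumes u: "u \<in> nonneg_sphere" and \<gamma>: "\<gamma> \<ge> 1"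
  obtains v where "v \<in> polar_grid \<gamma>"
    "\<And>i. \<bar>u $ i - v $ i\<bar> \<le> real CARD('n) * (pi / (2 * real \<gamma>))"
proof -
  obtain \<theta> where \<theta>: "\<And>j. 0 \<le> \<theta> j \<and> \<theta> j \<le> pi / 2" "polar_map \<theta> = u"
    using polar_map_surj[OF u] by blast
  define e where "e = pi / (2 * real \<gamma>)"
  have e: "e > 0" using \<gamma> by (simp add: e_def)
  define z where "z = (\<lambda>j. nat \<lfloor>\<theta> j / e\<rfloor>)"
  have z: "z j \<le> \<gamma>" "\<bar>\<theta> j - real (z j) * e\<bar> \<le> e" for j
  proof -
    have 0: "\<theta> j / e \<ge> 0" using \<theta>(1)[of j] e by simp
    have "\<theta> j / e \<le> (pi / 2) / e" using \<theta>(1)[of j] e by (intro divide_right_mono) auto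
    also have "\<dots> = real \<gamma>" using \<gamma> by (simp add: e_def)
    finally show "z j \<le> \<gamma>" unfolding z_def by linarith
    have "real (z j) = of_int \<lfloor>\<theta> j / e\<rfloor>" using 0 by (simp add: z_def)
    then have "\<bar>\<theta> j / e - real (z j)\<bar> \<le> 1" by linarith
    then have "\<bar>\<theta> j / e - real (z j)\<bar> * e \<le> 1 * e" using e by (intro mult_right_mono) auto
    moreover have "\<bar>\<theta> j / e - real (z j)\<bar> * e = \<bar>(\<theta> j / e - real (z j)) * e\<bar>"
      using e by (simp add: abs_mult)
    moreover have "(\<theta> j / e - real (z j)) * e = \<theta> j - real (z j) * e"
      using e by (simp add: field_simps)
    ultimately show "\<bar>\<theta> j - real (z j) * e\<bar> \<le> e" by simp
  qed
  define v where "v = (polar_map (\<lambda>j. real (z j) * pi / (2 * real \<gamma>)) :: real^('n::_))"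
  have "v \<in> polar_grid \<gamma>" using z(1) unfolding polar_grid_def v_def by auto
  moreover have "\<bar>u $ i - v $ i\<bar> \<le> real CARD('n) * (pi / (2 * real \<gamma>))" for i
    unfolding \<theta>(2)[symmetric] v_def
    by (rule polar_map_close) (use z(2) \<gamma> in \<open>auto simp: e_def\<close>)
  ultimately show ?thesis by (rule that)
qed

section \<open>The algorithms\<close>

text \<open>The set \<open>S\<close> certifies that the instance left over by \<open>B\<close> can
  be covered. For the first two conclusions this only serves to make the greedy loop terminate with
  a cover; the third compares sizes.\<close>

lemma asms_cover_bound:
  fixes \<D> :: "(real^'n) set"
  assumes D: "finite D" and \<tau>: "is_tie_rule \<tau>" and \<D>: "finite \<D>" and B: "B \<subseteq> D"
    and S: "S \<subseteq> D" "\<And>u. u \<in> \<D> \<Longrightarrow> top_tuples k u D \<inter> S \<noteq> {}"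
  shows "asms \<tau> D k B \<D> \<subseteq> D"
    and "\<And>u. u \<in> \<D> \<Longrightarrow> top_tuples k u D \<inter> asms \<tau> D k B \<D> \<noteq> {}"
    and "real (card (asms \<tau> D k B \<D>)) \<le> real (card B) + real (card S) * (1 + ln (real (card \<D>)))"
proof -
  define \<D>k where "\<D>k = {u \<in> \<D>. top_tuples k u D \<inter> B = {}}"
  define V where "V = (\<lambda>t. {u \<in> \<D>k. t \<in> top_tuples k u D})"
  define I where "I = {t \<in> D. V t \<noteq> {}}"
  define G where "G = greedy_cover (\<tau> k) \<D>k I V"
  have asms: "asms \<tau> D k B \<D> = B \<union> G"
    unfolding asms_def \<D>k_def V_def I_def G_def Let_def ..
  have finS: "finite S" using S(1) D finite_subset by blast
  have fin: "finite \<D>k" "finite I" using D \<D> by (auto simp: \<D>k_def I_def)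
  have pick: "\<tau> k P A \<in> A" if "A \<noteq> {}" for P A using \<tau> that by (simp add: is_tie_rule_def)
  \<comment> \<open>ASMS discards tuples whose set is empty, so the comparison cover is cut down to
    \<open>S \<inter> I\<close>; no covered direction is lost.\<close>
  have cov: "\<D>k \<subseteq> (\<Union>t\<in>S \<inter> I. V t)"
  proof
    fix u assume u: "u \<in> \<D>k"
    then obtain t where "t \<in> S" "t \<in> top_tuples k u D" using S(2)[of u] by (auto simp: \<D>k_def)
    with u S(1) show "u \<in> (\<Union>t\<in>S \<inter> I. V t)" by (auto simp: V_def I_def)
  qed
  have G: "G \<subseteq> I" "\<D>k \<subseteq> (\<Union>t\<in>G. V t)" "real (card G) \<le> real (card (S \<inter> I)) * harm (card \<D>k)"
    using greedy_cover_harm_bound[where pick = "\<tau> k", OF fin pick Int_lower2 cov, folded G_def] by simp_all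
  show "asms \<tau> D k B \<D> \<subseteq> D" using B G(1) by (auto simp: asms I_def)
  show "top_tuples k u D \<inter> asms \<tau> D k B \<D> \<noteq> {}" if "u \<in> \<D>" for u
  proof (cases "u \<in> \<D>k")
    case True
    then obtain t where "t \<in> G" "u \<in> V t" using G(2) by blast
    then show ?thesis by (auto simp: asms V_def)
  next
    case False
    then show ?thesis using that by (auto simp: asms \<D>k_def)
  qed
  have harm: "harm (card \<D>k) \<le> 1 + ln (real (card \<D>))"
  proof (cases "\<D>k = {}")
    case True
    have "0 \<le> ln (real (card \<D>))" by (cases "card \<D>") auto
    then show ?thesis using True by (simp add: harm_def)
  next
    case False
    then have 1: "1 \<le> card \<D>k" using fin by (simp add: Suc_le_eq card_gt_0_iff)
    then have "harm (card \<D>k) \<le> 1 + ln (real (card \<D>k))" by (rule harm_le_one_plus_ln)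
    also have "card \<D>k \<le> card \<D>" using \<D> by (intro card_mono) (auto simp: \<D>k_def)
    then have "ln (real (card \<D>k)) \<le> ln (real (card \<D>))" using 1 by simp
    finally show ?thesis by simp
  qed
  have "real (card (asms \<tau> D k B \<D>)) \<le> real (card B) + real (card G)"
    unfolding asms using card_Un_le[of B G] by linarith
  also note G(3)
  also have "real (card (S \<inter> I)) * harm (card \<D>k) \<le> real (card S) * (1 + ln (real (card \<D>)))"
    using harm finS by (intro mult_mono) (auto intro: card_mono harm_nonneg)
  finally show "real (card (asms \<tau> D k B \<D>)) \<le> real (card B) + real (card S) * (1 + ln (real (card \<D>)))"
    by simp
qed

lemma top_tuples_Int_iff:
  assumes "finite D" "S \<subseteq> D" "S \<noteq> {}"
  shows "top_tuples k u D \<inter> S \<noteq> {} \<longleftrightarrow> set_rank D u S \<le> k"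
  unfolding set_rank_le_iff[OF assms] using assms(2) by (auto simp: top_tuples_def)

text \<open>Here \<open>D\<close> itself serves as the certifying cover, since a tuple of maximal
  utility has rank 1. Hence the conclusion holds at every positive threshold, however large the
  output may be.\<close>

lemma asms_rank_le:
  fixes \<D> :: "(real^'n) set"
  assumes D: "finite D" and \<tau>: "is_tie_rule \<tau>" and \<D>: "finite \<D>" and B: "B \<subseteq> D" "B \<noteq> {}"
    and k: "1 \<le> k"
  shows "asms \<tau> D k B \<D> \<subseteq> D" "asms \<tau> D k B \<D> \<noteq> {}"
    and "\<And>u. u \<in> \<D> \<Longrightarrow> set_rank D u (asms \<tau> D k B \<D>) \<le> k"
proof -
  have cov: "top_tuples k u D \<inter> D \<noteq> {}" for u
  proof -
    have "D \<noteq> {}" using B by auto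
    then obtain t where "t \<in> D" "tuple_rank D u t = 1" using exists_top_tuple D by blast
    then show ?thesis using k by (auto simp: top_tuples_def)
  qed
  note props = asms_cover_bound[OF D \<tau> \<D> B(1) order.refl, where k = k, OF cov]
  show 1: "asms \<tau> D k B \<D> \<subseteq> D" by (rule props)
  show 2: "asms \<tau> D k B \<D> \<noteq> {}" using B(2) by (auto simp: asms_def Let_def)
  show "set_rank D u (asms \<tau> D k B \<D>) \<le> k" if "u \<in> \<D>" for u
    using props(2)[OF that] top_tuples_Int_iff[OF D 1 2] by blast
qed

lemma hdrrm_eq_doubling_bisection:
  "hdrrm \<tau> b \<omega> D r \<gamma> m = doubling_bisection (\<lambda>Q. card Q \<le> r)
     (\<lambda>k. asms \<tau> D k (range b) (discrete_dirs \<gamma> m \<omega>)) (card D)"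
  unfolding hdrrm_def doubling_bisection_def Let_def by (rule refl)

lemma hdrrm_Some_asms:
  assumes "hdrrm \<tau> b \<omega> D r \<gamma> m = Some R"
  shows "\<exists>k\<ge>1. R = asms \<tau> D k (range b) (discrete_dirs \<gamma> m \<omega>)"
  using doubling_bisection_range[OF assms[unfolded hdrrm_eq_doubling_bisection]] .

lemma hdrrm_Some:
  assumes "\<And>k. k \<ge> ks \<Longrightarrow> card (asms \<tau> D k (range b) (discrete_dirs \<gamma> m \<omega>)) \<le> r"
    and "1 \<le> ks" "ks \<le> card D"
  shows "\<exists>k\<ge>1. k \<le> ks \<and> card (asms \<tau> D k (range b) (discrete_dirs \<gamma> m \<omega>)) \<le> r \<and>
    hdrrm \<tau> b \<omega> D r \<gamma> m = Some (asms \<tau> D k (range b) (discrete_dirs \<gamma> m \<omega>))"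
  unfolding hdrrm_eq_doubling_bisection
  by (rule doubling_bisection_Some[where ok = "\<lambda>Q. card Q \<le> r" and
        Q = "\<lambda>k. asms \<tau> D k (range b) (discrete_dirs \<gamma> m \<omega>)", OF assms])

lemma discrete_dirs_finite_card:
  fixes \<omega> :: "nat \<Rightarrow> real^('n::{finite,linorder})"
  shows "finite (discrete_dirs \<gamma> m \<omega>)"
    and "card (discrete_dirs \<gamma> m \<omega>) \<le> (\<gamma> + 1) ^ (CARD('n) - 1) + m"
proof -
  have "card (\<omega> ` {..<m}) \<le> m" using card_image_le[of "{..<m}" \<omega>] by simp
  then show "card (discrete_dirs \<gamma> m \<omega>) \<le> (\<gamma> + 1) ^ (CARD('n) - 1) + m"
    unfolding discrete_dirs_def
    using card_Un_le[of "\<omega> ` {..<m}" "polar_grid \<gamma>"] polar_grid_finite_card[of \<gamma>, where ?'n = 'n]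
    by linarith
  show "finite (discrete_dirs \<gamma> m \<omega>)"
    using polar_grid_finite_card[of \<gamma>, where ?'n = 'n] by (simp add: discrete_dirs_def)
qed

lemma opt_rank_bounds:
  fixes D :: "(real^'n) set"
  assumes "finite D" "D \<noteq> {}" "1 \<le> s"
  shows "1 \<le> opt_rank D s" "opt_rank D s \<le> card D"
proof -
  obtain S where S: "S \<subseteq> D" "S \<noteq> {}" "max_rank D nonneg_sphere S = opt_rank D s"
    using opt_rank_attained[OF assms] by blast
  have ne: "(nonneg_sphere :: (real^'n) set) \<noteq> {}" using axis_in_nonneg_sphere by blast
  show "1 \<le> opt_rank D s" "opt_rank D s \<le> card D"
    using max_rank_bounds[OF assms(1) S(1,2) ne] S(3) by auto
qed

lemma hdrrm_guarantee:
  fixes D :: "(real^('n::{finite,linorder})) set" and \<omega> :: "nat \<Rightarrow> real^('n::_)"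
  assumes s_def: "s = (real r - real CARD('n)) / (1 + ln (real (card (discrete_dirs \<gamma> m \<omega>))))"
    and D: "is_dataset D" and b: "boundary_tuples D b" and \<tau>: "is_tie_rule \<tau>"
    and \<gamma>: "\<gamma> \<ge> 1" and \<omega>: "\<forall>i<m. \<omega> i \<in> nonneg_sphere" and s: "\<lfloor>s\<rfloor> \<ge> 1"
  obtains R where "hdrrm \<tau> b \<omega> D r \<gamma> m = Some R" "range b \<subseteq> R" "R \<subseteq> D" "card R \<le> r"
    "\<forall>u\<in>discrete_dirs \<gamma> m \<omega>. set_rank D u R \<le> opt_rank D s"
    "max_rank D (discrete_dirs \<gamma> m \<omega>) R \<le> opt_rank D s"
proof -
  define \<D> where "\<D> = discrete_dirs \<gamma> m \<omega>"
  define ks where "ks = opt_rank D s"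
  have finD: "finite D" using D by (simp add: is_dataset_def)
  have B: "range b \<subseteq> D" "range b \<noteq> {}" using b by (auto simp: boundary_tuples_def)
  then have D0: "D \<noteq> {}" by blast
  have s1: "1 \<le> s" using s by linarith
  have fin: "finite \<D>" by (simp add: \<D>_def discrete_dirs_finite_card)
  have sub: "\<D> \<subseteq> nonneg_sphere"
    using \<omega> polar_grid_subset_sphere[OF \<gamma>] by (auto simp: \<D>_def discrete_dirs_def)
  \<comment> \<open>A grid point makes \<open>\<D>\<close> nonempty, so
    \<open>1 + ln (card \<D>)\<close> is positive and cancels against the denominator of
    \<open>s\<close>.\<close>
  have "polar_map (\<lambda>j. real 0 * pi / (2 * real \<gamma>)) \<in> (polar_grid \<gamma> :: (real^('n::_)) set)"
    unfolding polar_grid_def by (intro CollectI exI[of _ "\<lambda>_. 0"]) simp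
  then have \<D>0: "\<D> \<noteq> {}" by (auto simp: \<D>_def discrete_dirs_def)
  have L: "0 < 1 + ln (real (card \<D>))"
    using fin \<D>0 by (intro add_pos_nonneg) (auto simp: Suc_le_eq card_gt_0_iff)
  obtain S where S: "S \<subseteq> D" "S \<noteq> {}" "real (card S) \<le> s" "max_rank D nonneg_sphere S = ks"
    unfolding ks_def using opt_rank_attained[OF finD D0 s1] by blast
  have ks: "1 \<le> ks" "ks \<le> card D" unfolding ks_def by (rule opt_rank_bounds[OF finD D0 s1])+
  have Srank: "set_rank D u S \<le> ks" if "u \<in> \<D>" for u
    using max_rank_le_iff[OF finD S(1,2), of nonneg_sphere ks] sub that S(4) by blast
  have ok: "card (asms \<tau> D k (range b) \<D>) \<le> r" if k: "k \<ge> ks" for k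
  proof -
    have "top_tuples k u D \<inter> S \<noteq> {}" if "u \<in> \<D>" for u
      using Srank[OF that] k by (simp add: top_tuples_Int_iff[OF finD S(1,2)])
    then have "real (card (asms \<tau> D k (range b) \<D>)) \<le> real (card (range b)) + real (card S) * (1 + ln (real (card \<D>)))"
      by (rule asms_cover_bound(3)[OF finD \<tau> fin B(1) S(1)])
    also have "real (card S) * (1 + ln (real (card \<D>))) \<le> s * (1 + ln (real (card \<D>)))"
      using S(3) L by (intro mult_right_mono) auto
    also have "s * (1 + ln (real (card \<D>))) = real r - real CARD('n)"
      using L by (simp add: s_def \<D>_def)
    also have "card (range b) \<le> CARD('n)" by (rule card_image_le) simp
    finally show ?thesis by simp
  qed
  obtain k where k: "k \<ge> 1" "k \<le> ks" "card (asms \<tau> D k (range b) \<D>) \<le> r"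
    "hdrrm \<tau> b \<omega> D r \<gamma> m = Some (asms \<tau> D k (range b) \<D>)"
    using hdrrm_Some[of ks \<tau> D b \<gamma> m \<omega> r, folded \<D>_def, OF ok ks] by (auto simp only:)
  note props = asms_rank_le[OF finD \<tau> fin B k(1)]
  have "\<forall>u\<in>\<D>. set_rank D u (asms \<tau> D k (range b) \<D>) \<le> ks"
    using order_trans[OF props(3) k(2)] by blast
  moreover from this have "max_rank D \<D> (asms \<tau> D k (range b) \<D>) \<le> ks"
    unfolding max_rank_le_iff[OF finD props(1,2) \<D>0] by blast
  moreover have "range b \<subseteq> asms \<tau> D k (range b) \<D>" by (simp add: asms_def Let_def)
  ultimately show ?thesis
    using k(3,4) props(1) unfolding \<D>_def ks_def
    by (intro that[of "asms \<tau> D k (range b) (discrete_dirs \<gamma> m \<omega>)"])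
qed

section \<open>Dependence of the output on counts of directions\<close>

text \<open>These counts determine every run of ASMS, see \<open>asms_cong\<close>: the greedy algorithm only compares
  cardinalities.\<close>

definition class_count :: "(real^'n) set \<Rightarrow> (real^'n) set \<Rightarrow> nat \<Rightarrow> (real^'n) set \<Rightarrow> nat" where
  "class_count D \<D> k X = card {u \<in> \<D>. top_tuples k u D = X}"

text \<open>Directions are partitioned by their set of top tuples, so any cardinality described
  through top tuples alone is a sum of class counts.\<close>

lemma card_top_tuples_pred:
  assumes "finite D" "finite \<D>"
  shows "card {u \<in> \<D>. P (top_tuples k u D)} = (\<Sum>X | X \<subseteq> D \<and> P X. class_count D \<D> k X)"
proof -
  have "{u \<in> \<D>. P (top_tuples k u D)} = (\<Union>X\<in>{X. X \<subseteq> D \<and> P X}. {u \<in> \<D>. top_tuples k u D = X})"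
    by (auto simp: top_tuples_def)
  also have "card \<dots> = (\<Sum>X\<in>{X. X \<subseteq> D \<and> P X}. card {u \<in> \<D>. top_tuples k u D = X})"
    by (rule card_UN_disjoint) (use assms in auto)
  finally show ?thesis by (simp add: class_count_def)
qed

lemma asms_cong:
  fixes \<D> \<D>' :: "(real^'n) set"
  assumes D: "finite D" and fin: "finite \<D>" "finite \<D>'"
    and eq: "\<And>X. X \<subseteq> D \<Longrightarrow> class_count D \<D> k X = class_count D \<D>' k X"
  shows "asms \<tau> D k B \<D> = asms \<tau> D k B \<D>'"
proof -
  define T where "T = (\<lambda>u. top_tuples k u D)"
  define V where "V = (\<lambda>\<D> t. {u \<in> {u \<in> \<D>. T u \<inter> B = {}}. t \<in> T u})"
  define W where "W = (\<lambda>\<D> P. {u \<in> \<D>. T u \<inter> B = {}} - (\<Union>t\<in>P. V \<D> t))"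
  have card_eq: "card {u \<in> \<D>. P (T u)} = card {u \<in> \<D>'. P (T u)}" for P
    unfolding T_def using card_top_tuples_pred[OF D fin(1)] card_top_tuples_pred[OF D fin(2)] eq
    by (auto intro!: sum.cong)
  have W: "W \<D> P = {u \<in> \<D>. T u \<inter> B = {} \<and> T u \<inter> P = {}}" for \<D> P
    by (auto simp: W_def V_def)
  have VW: "V \<D> t \<inter> W \<D> P = {u \<in> \<D>. t \<in> T u \<and> T u \<inter> B = {} \<and> T u \<inter> P = {}}" for \<D> t P
    by (auto simp: W_def V_def)
  have V: "V \<D> t = {u \<in> \<D>. T u \<inter> B = {} \<and> t \<in> T u}" for \<D> t by (auto simp: V_def)
  have empty_iff: "({u \<in> \<D>. P (T u)} = {}) = ({u \<in> \<D>'. P (T u)} = {})" for P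
  proof -
    have "finite {u \<in> \<D>. P (T u)}" "finite {u \<in> \<D>'. P (T u)}" using fin by simp_all
    then show ?thesis using card_eq[of P] by (simp only: card_0_eq[symmetric])
  qed
  have I: "{t \<in> D. V \<D> t \<noteq> {}} = {t \<in> D. V \<D>' t \<noteq> {}}"
    unfolding V using empty_iff[of "\<lambda>X. X \<inter> B = {} \<and> _ \<in> X"] by auto
  have Wn: "(\<lambda>P. W \<D> P \<noteq> {}) = (\<lambda>P. W \<D>' P \<noteq> {})"
    unfolding W using empty_iff[of "\<lambda>X. X \<inter> B = {} \<and> X \<inter> _ = {}"] by auto
  have Wa: "{u \<in> \<D>. T u \<inter> B = {}} - (\<Union>t\<in>P. V \<D> t) = W \<D> P" for \<D> P
    by (simp add: W_def)
  have cVW: "card (V \<D> t \<inter> W \<D> P) = card (V \<D>' t \<inter> W \<D>' P)" for t P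
    unfolding VW by (rule card_eq)
  \<comment> \<open>The ground sets differ, but loop condition, index set and gains agree as
    functions of the set picked so far; after rewriting, both loops are the same term.\<close>
  have "greedy_cover (\<tau> k) {u \<in> \<D>. T u \<inter> B = {}} {t \<in> D. V \<D> t \<noteq> {}} (V \<D>) =
        greedy_cover (\<tau> k) {u \<in> \<D>'. T u \<inter> B = {}} {t \<in> D. V \<D>' t \<noteq> {}} (V \<D>')"
    unfolding greedy_cover_def Let_def Wa Wn cVW I ..
  then show ?thesis unfolding asms_def Let_def T_def V_def by (simp only:)
qed

text \<open>From \<open>card D\<close> on every tuple is a top tuple. So finitely many thresholds
  carry all the information, although the search may try larger ones.\<close>

lemma class_count_ge_card:
  assumes "finite D" "k \<ge> card D"
  shows "class_count D \<D> k X = class_count D \<D> (card D) X"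
proof -
  have "top_tuples k u D = D" if "k \<ge> card D" for u k
    using order_trans[OF tuple_rank_le_card[OF assms(1)] that] by (auto simp: top_tuples_def)
  then show ?thesis using assms(2) by (simp add: class_count_def)
qed

lemma hdrrm_cong:
  fixes \<omega> \<omega>' :: "nat \<Rightarrow> real^('n::{finite,linorder})"
  assumes D: "finite D"
    and eq: "\<And>k X. k \<le> card D \<Longrightarrow> X \<subseteq> D \<Longrightarrow>
      class_count D (discrete_dirs \<gamma> m \<omega>) k X = class_count D (discrete_dirs \<gamma> m \<omega>') k X"
  shows "hdrrm \<tau> b \<omega> D r \<gamma> m = hdrrm \<tau> b \<omega>' D r \<gamma> m"
    and "card (discrete_dirs \<gamma> m \<omega>) = card (discrete_dirs \<gamma> m \<omega>')"
proof -
  have eq': "class_count D (discrete_dirs \<gamma> m \<omega>) k X = class_count D (discrete_dirs \<gamma> m \<omega>') k X"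
    if "X \<subseteq> D" for k X
    using eq[of k X] eq[of "card D" X] that class_count_ge_card[OF D, of k]
    by (cases "k \<le> card D") auto
  have "asms \<tau> D k B (discrete_dirs \<gamma> m \<omega>) = asms \<tau> D k B (discrete_dirs \<gamma> m \<omega>')" for k B
    by (rule asms_cong[OF D discrete_dirs_finite_card(1) discrete_dirs_finite_card(1) eq'])
  then show "hdrrm \<tau> b \<omega> D r \<gamma> m = hdrrm \<tau> b \<omega>' D r \<gamma> m" unfolding hdrrm_def Let_def by (simp only:)
  \<comment> \<open>With a predicate that is always true the counts add up to the whole cardinality;
    the threshold 0 is an arbitrary choice.\<close>
  show "card (discrete_dirs \<gamma> m \<omega>) = card (discrete_dirs \<gamma> m \<omega>')"
    using card_top_tuples_pred[where P = "\<lambda>_. True" and k = 0, OF D discrete_dirs_finite_card(1)[of \<gamma> m \<omega>]]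
      card_top_tuples_pred[where P = "\<lambda>_. True" and k = 0, OF D discrete_dirs_finite_card(1)[of \<gamma> m \<omega>']] eq'
    by (auto intro!: sum.cong)
qed

section \<open>Measurability\<close>

lemma closed_nonneg_orthant: "closed {x :: real^'n. \<forall>i. 0 \<le> x $ i}"
  by (intro closed_Collect_all closed_Collect_le continuous_intros)

lemma nonneg_sphere_borel: "nonneg_sphere \<in> sets (borel :: (real^'n) measure)"
proof -
  have "nonneg_sphere = {x :: real^'n. \<forall>i. 0 \<le> x $ i} \<inter> sphere 0 1"
    by (auto simp: nonneg_sphere_def)
  moreover have "closed ({x :: real^'n. \<forall>i. 0 \<le> x $ i} \<inter> sphere 0 1)"
    by (intro closed_Int closed_nonneg_orthant closed_sphere)
  ultimately show ?thesis by (metis borel_closed)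
qed

text \<open>Positive finite measure is what makes \<open>uniform_measure\<close> a probability
  measure here. For positivity a cube of side \<open>1 / d\<close> fits into the ball, since its
  points have l1 norm at most 1.\<close>

lemma nonneg_ball_emeasure:
  defines "A \<equiv> {x :: real^'n. (\<forall>i. 0 \<le> x $ i) \<and> norm x \<le> 1}"
  shows "emeasure lborel A \<noteq> 0" "emeasure lborel A < \<infinity>" "A \<in> sets lborel"
proof -
  have A: "A = {x. \<forall>i. 0 \<le> x $ i} \<inter> cball 0 1" by (auto simp: A_def)
  show meas: "A \<in> sets lborel"
    unfolding A by (simp add: closed_nonneg_orthant borel_closed closed_Int)
  have "bounded A" unfolding A by (intro bounded_Int disjI2 bounded_cball)
  then show "emeasure lborel A < \<infinity>" by (rule emeasure_bounded_finite)
  define c where "c = 1 / real CARD('n)"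
  have c: "c > 0" by (simp add: c_def)
  define v where "v = (\<chi> i. c :: real^'n)"
  have sub: "cbox 0 v \<subseteq> A"
  proof
    fix x :: "real^'n" assume "x \<in> cbox 0 v"
    then have x: "0 \<le> x $ i" "x $ i \<le> c" for i by (auto simp: mem_box_cart v_def)
    have "norm x \<le> (\<Sum>i\<in>UNIV. \<bar>x $ i\<bar>)" by (rule norm_le_l1_cart)
    also have "\<dots> \<le> (\<Sum>i\<in>(UNIV::'n set). c)" using x by (intro sum_mono) auto
    also have "\<dots> = 1" by (simp add: c_def)
    finally show "x \<in> A" using x by (simp add: A_def)
  qed
  have "v \<bullet> b = c" if "b \<in> Basis" for b :: "real^'n"
    using that by (auto simp: Basis_vec_def inner_axis v_def)
  then have "emeasure lborel (cbox 0 v) = ennreal (c ^ CARD('n))"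
    using c by (subst emeasure_lborel_cbox) auto
  also have "\<dots> \<noteq> 0" using c by simp
  finally show "emeasure lborel A \<noteq> 0"
    using emeasure_mono[OF sub, of lborel] meas by auto
qed

lemma sgn_borel_measurable [measurable]: "sgn \<in> borel_measurable (borel :: (real^'n) measure)"
proof -
  have "(\<lambda>x :: real^'n. x /\<^sub>R norm x) \<in> borel_measurable borel" by measurable
  then show ?thesis by (simp add: sgn_div_norm[abs_def])
qed

lemma prob_space_uniform_nonneg_sphere: "prob_space (uniform_nonneg_sphere :: (real^'n) measure)"
  unfolding uniform_nonneg_sphere_def
  by (intro prob_space.prob_space_distr prob_space_uniform_measure)
    (use nonneg_ball_emeasure[where 'n = 'n] in \<open>auto simp: less_top\<close>)

lemma sets_uniform_nonneg_sphere [measurable_cong, simp]: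
  "sets (uniform_nonneg_sphere :: (real^'n) measure) = sets borel"
  by (simp add: uniform_nonneg_sphere_def)

lemma space_uniform_nonneg_sphere [simp]:
  "space (uniform_nonneg_sphere :: (real^'n) measure) = UNIV"
  by (simp add: uniform_nonneg_sphere_def)

text \<open>Only the origin is projected off the sphere, because \<open>sgn 0 = 0\<close>, and a
  single point is a null set.\<close>

lemma AE_uniform_nonneg_sphere: "AE u :: real^'n in uniform_nonneg_sphere. u \<in> nonneg_sphere"
proof -
  note [measurable] = nonneg_sphere_borel
  have "AE x in lborel. x \<in> {x :: real^'n. (\<forall>i. 0 \<le> x $ i) \<and> norm x \<le> 1} \<longrightarrow> sgn x \<in> nonneg_sphere"
    using AE_lborel_singleton[of 0]
  proof (rule AE_mp, intro AE_I2 impI)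
    fix x :: "real^'n"
    assume "x \<noteq> 0" "x \<in> {x. (\<forall>i. 0 \<le> x $ i) \<and> norm x \<le> 1}"
    then show "sgn x \<in> nonneg_sphere"
      by (simp add: nonneg_sphere_def norm_sgn) (simp add: sgn_div_norm)
  qed
  then show ?thesis
    unfolding uniform_nonneg_sphere_def
    using nonneg_ball_emeasure[where 'n = 'n]
    by (subst AE_distr_iff) (auto simp: AE_uniform_measure nonneg_sphere_borel)
qed

lemma prob_space_sample_space: "prob_space (sample_space m :: (nat \<Rightarrow> real^'n) measure)"
  unfolding sample_space_def by (rule prob_space_PiM[OF prob_space_uniform_nonneg_sphere])

lemma AE_sample_space: "AE \<omega> :: nat \<Rightarrow> real^'n in sample_space m. \<forall>i<m. \<omega> i \<in> nonneg_sphere"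
proof -
  have "AE \<omega> :: nat \<Rightarrow> real^'n in sample_space m. \<forall>i\<in>{..<m}. \<omega> i \<in> nonneg_sphere"
    unfolding sample_space_def
    by (intro AE_finite_allI AE_PiM_component prob_space_uniform_nonneg_sphere
        AE_uniform_nonneg_sphere) auto
  then show ?thesis by (simp add: Ball_def)
qed

section \<open>Measurability of ranks and of the output\<close>

lemma tuple_rank_borel_measurable:
  assumes "finite D"
  shows "(\<lambda>u. real (tuple_rank D u t)) \<in> borel_measurable borel"
proof -
  have "real (tuple_rank D u t) = 1 + (\<Sum>t'\<in>D. if u \<bullet> t < u \<bullet> t' then 1 else 0)" for u
    using assms by (simp add: tuple_rank_def sum.If_cases Int_def conj_commute)
  then show ?thesis by simp
qed

lemma tuple_rank_le_borel:
  assumes "finite D"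
  shows "{u. tuple_rank D u t \<le> k} \<in> sets borel"
proof -
  note [measurable] = tuple_rank_borel_measurable[OF assms]
  have "{u \<in> space borel. real (tuple_rank D u t) \<le> real k} \<in> sets borel" by measurable
  then show ?thesis by simp
qed

lemma set_rank_le_borel:
  assumes "finite D" "S \<subseteq> D" "S \<noteq> {}"
  shows "{u. set_rank D u S \<le> k} \<in> sets borel"
proof -
  have "{u. set_rank D u S \<le> k} = (\<Union>t\<in>S. {u. tuple_rank D u t \<le> k})"
    by (auto simp: set_rank_le_iff[OF assms])
  moreover have "finite S" using assms finite_subset by blast
  ultimately show ?thesis using tuple_rank_le_borel[OF assms(1)] by auto
qed

lemma top_tuples_eq_borel:
  assumes "finite D" "X \<subseteq> D"
  shows "{u. top_tuples k u D = X} \<in> sets borel"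
proof -
  have "{u. top_tuples k u D = X} =
    (\<Inter>t\<in>D. if t \<in> X then {u. tuple_rank D u t \<le> k} else - {u. tuple_rank D u t \<le> k})"
    using assms(2) by (auto simp: top_tuples_def split: if_splits)
  moreover have "\<dots> \<in> sets borel"
  proof (cases "D = {}")
    case False
    have "(if t \<in> X then {u. tuple_rank D u t \<le> k} else - {u. tuple_rank D u t \<le> k}) \<in> sets borel" for t
      using tuple_rank_le_borel[OF assms(1), of t k] by auto
    then show ?thesis using assms(1) False by (intro sets.finite_INT) auto
  qed simp
  ultimately show ?thesis by simp
qed

text \<open>Samples may coincide with each other or lie in \<open>G\<close>, so the count is not a
  plain sum of indicators. Adding the samples one at a time, a new one contributes only if it lies
  in \<open>C\<close> and has not occurred before.\<close>

lemma card_samples_measurable: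
  fixes G C :: "(real^'n) set"
  assumes G: "finite G" and C: "C \<in> sets borel" and "j \<le> m"
  shows "(\<lambda>\<omega>. real (card {u \<in> \<omega> ` {..<j} \<union> G. u \<in> C})) \<in> borel_measurable (sample_space m)"
  using \<open>j \<le> m\<close>
proof (induction j)
  case 0
  show ?case by simp
next
  case (Suc j)
  have comp: "(\<lambda>\<omega>. \<omega> i) \<in> borel_measurable (sample_space m :: (nat \<Rightarrow> real^'n) measure)" if "i < m" for i
    unfolding sample_space_def using that
    by (subst measurable_cong_sets[OF refl sets_uniform_nonneg_sphere[symmetric]])
      (rule measurable_component_singleton, simp)
  have [measurable]: "(\<lambda>\<omega>. \<omega> j) \<in> borel_measurable (sample_space m :: (nat \<Rightarrow> real^'n) measure)"
    by (rule comp) (use Suc in simp)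
  have G': "G \<in> sets borel" using G by (simp add: borel_closed finite_imp_closed)
  note [measurable] = C G'
  have eq: "Measurable.pred (sample_space m) (\<lambda>\<omega> :: nat \<Rightarrow> real^'n. \<omega> j = \<omega> i)" if "i < j" for i
  proof -
    have [measurable]: "(\<lambda>\<omega>. \<omega> i) \<in> borel_measurable (sample_space m :: (nat \<Rightarrow> real^'n) measure)"
      by (rule comp) (use Suc that in simp)
    \<comment> \<open>Coincidence of two samples is phrased as a vanishing norm, which reduces it to
      a real-valued function.\<close>
    have "Measurable.pred (sample_space m) (\<lambda>\<omega> :: nat \<Rightarrow> real^'n. norm (\<omega> j - \<omega> i) = 0)"
      by measurable
    then show ?thesis by simp
  qed
  have "Measurable.pred (sample_space m) (\<lambda>\<omega> :: nat \<Rightarrow> real^'n. \<exists>i\<in>{..<j}. \<omega> j = \<omega> i)"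
    by (rule pred_intros_finite) (use eq in auto)
  moreover have "Measurable.pred (sample_space m) (\<lambda>\<omega>. \<omega> j \<in> C)"
    "Measurable.pred (sample_space m) (\<lambda>\<omega>. \<omega> j \<in> G)" by measurable
  ultimately have [measurable]: "Measurable.pred (sample_space m)
      (\<lambda>\<omega>. \<omega> j \<in> C \<and> \<not> ((\<exists>i\<in>{..<j}. \<omega> j = \<omega> i) \<or> \<omega> j \<in> G))"
    by (intro pred_intros_logic)
  have "card {u \<in> \<omega> ` {..<Suc j} \<union> G. u \<in> C} = card {u \<in> \<omega> ` {..<j} \<union> G. u \<in> C} +
    (if \<omega> j \<in> C \<and> \<not> ((\<exists>i\<in>{..<j}. \<omega> j = \<omega> i) \<or> \<omega> j \<in> G) then 1 else 0)" for \<omega>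
  proof (cases "\<omega> j \<in> C \<and> \<not> ((\<exists>i\<in>{..<j}. \<omega> j = \<omega> i) \<or> \<omega> j \<in> G)")
    case True
    then have "{u \<in> \<omega> ` {..<Suc j} \<union> G. u \<in> C} = insert (\<omega> j) {u \<in> \<omega> ` {..<j} \<union> G. u \<in> C}"
      "\<omega> j \<notin> {u \<in> \<omega> ` {..<j} \<union> G. u \<in> C}"
      by (auto simp: lessThan_Suc)
    moreover have "finite {u \<in> \<omega> ` {..<j} \<union> G. u \<in> C}" using G by simp
    ultimately show ?thesis using True by simp
  next
    case False
    then have "{u \<in> \<omega> ` {..<Suc j} \<union> G. u \<in> C} = {u \<in> \<omega> ` {..<j} \<union> G. u \<in> C}"
      by (auto simp: lessThan_Suc)
    then show ?thesis using False by simp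
  qed
  then have eq_Suc: "(\<lambda>\<omega>. real (card {u \<in> \<omega> ` {..<Suc j} \<union> G. u \<in> C})) =
    (\<lambda>\<omega>. real (card {u \<in> \<omega> ` {..<j} \<union> G. u \<in> C}) +
      (if \<omega> j \<in> C \<and> \<not> ((\<exists>i\<in>{..<j}. \<omega> j = \<omega> i) \<or> \<omega> j \<in> G) then 1 else 0))"
    by (auto simp del: Un_iff mem_Collect_eq)
  have "(\<lambda>\<omega>. if \<omega> j \<in> C \<and> \<not> ((\<exists>i\<in>{..<j}. \<omega> j = \<omega> i) \<or> \<omega> j \<in> G) then 1 else 0 :: real)
      \<in> borel_measurable (sample_space m)"
    by measurable
  with Suc show ?case unfolding eq_Suc by (intro borel_measurable_add) simp_all
qed

lemma class_count_measurable:
  assumes "finite D" "X \<subseteq> D"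
  shows "(\<lambda>\<omega>. real (class_count D (discrete_dirs \<gamma> m \<omega>) k X)) \<in> borel_measurable (sample_space m)"
  using card_samples_measurable[OF conjunct1[OF polar_grid_finite_card] top_tuples_eq_borel[OF assms, of k] order.refl]
  unfolding class_count_def discrete_dirs_def by simp

text \<open>Finitely many natural numbers take only countably many joint values, so the set is a
  countable union of measurable fibres. This allows a \<open>Q\<close> such as a run of the
  algorithm under an arbitrary tie rule.\<close>

lemma sets_Collect_finitely_determined:
  fixes f :: "'i \<Rightarrow> 'a \<Rightarrow> nat"
  assumes J: "finite J" and f: "\<And>j. j \<in> J \<Longrightarrow> (\<lambda>\<omega>. real (f j \<omega>)) \<in> borel_measurable M"
    and Q: "\<And>\<omega> \<omega>'. (\<And>j. j \<in> J \<Longrightarrow> f j \<omega> = f j \<omega>') \<Longrightarrow> Q \<omega> = Q \<omega>'"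
  shows "{\<omega> \<in> space M. Q \<omega>} \<in> sets M"
proof -
  define F where "F = (\<lambda>\<omega>. restrict (\<lambda>j. f j \<omega>) J)"
  have "F ` {\<omega> \<in> space M. Q \<omega>} \<subseteq> PiE J (\<lambda>_. UNIV)" by (auto simp: F_def)
  moreover have "countable (PiE J (\<lambda>_. UNIV :: nat set))" using J by (intro countable_PiE) auto
  ultimately have cnt: "countable (F ` {\<omega> \<in> space M. Q \<omega>})" by (rule countable_subset)
  have fib: "{\<omega> \<in> space M. \<forall>j\<in>J. f j \<omega> = p j} \<in> sets M" for p
  proof (rule sets.sets_Collect_finite_All[OF _ J])
    fix j assume "j \<in> J"
    then have [measurable]: "(\<lambda>\<omega>. real (f j \<omega>)) \<in> borel_measurable M" by (rule f)
    have "{\<omega> \<in> space M. real (f j \<omega>) = real (p j)} \<in> sets M" by measurable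
    then show "{\<omega> \<in> space M. f j \<omega> = p j} \<in> sets M" by simp
  qed
  have "{\<omega> \<in> space M. Q \<omega>} = (\<Union>p\<in>F ` {\<omega> \<in> space M. Q \<omega>}. {\<omega> \<in> space M. \<forall>j\<in>J. f j \<omega> = p j})"
    (is "?L = ?R")
  proof
    show "?L \<subseteq> ?R" by (auto simp: F_def)
    show "?R \<subseteq> ?L"
    proof
      fix \<omega> assume "\<omega> \<in> ?R"
      then obtain \<omega>' where "\<omega> \<in> space M" "Q \<omega>'" "\<forall>j\<in>J. f j \<omega> = F \<omega>' j" by auto
      then show "\<omega> \<in> ?L" using Q[of \<omega> \<omega>'] by (simp add: F_def)
    qed
  qed
  also have "\<dots> \<in> sets M" using cnt fib by (intro sets.countable_UN') auto
  finally show ?thesis .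
qed

text \<open>The predicate \<open>P\<close> is there for the optimal rank, which depends on the
  samples through the number of distinct directions.\<close>

lemma hdrrm_Collect_sets:
  fixes D :: "(real^('n::{finite,linorder})) set"
  assumes D: "finite D"
  shows "{\<omega> \<in> space (sample_space m). hdrrm \<tau> b \<omega> D r \<gamma> m = Some R \<and>
    P (card (discrete_dirs \<gamma> m \<omega>))} \<in> sets (sample_space m)"
proof (rule sets_Collect_finitely_determined[where J = "{..card D} \<times> Pow D" and
      f = "\<lambda>(k, X) \<omega>. class_count D (discrete_dirs \<gamma> m \<omega>) k X"])
  show "finite ({..card D} \<times> Pow D)" using D by simp
  show "(\<lambda>\<omega>. real ((case j of (k, X) \<Rightarrow> \<lambda>\<omega>. class_count D (discrete_dirs \<gamma> m \<omega>) k X) \<omega>))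
      \<in> borel_measurable (sample_space m)" if "j \<in> {..card D} \<times> Pow D" for j
    using that class_count_measurable[OF D] by (auto split: prod.splits)
  fix \<omega> \<omega>' :: "nat \<Rightarrow> real^('n::_)"
  assume eq: "\<And>j. j \<in> {..card D} \<times> Pow D \<Longrightarrow>
    (case j of (k, X) \<Rightarrow> \<lambda>\<omega>. class_count D (discrete_dirs \<gamma> m \<omega>) k X) \<omega> =
    (case j of (k, X) \<Rightarrow> \<lambda>\<omega>. class_count D (discrete_dirs \<gamma> m \<omega>) k X) \<omega>'"
  have "class_count D (discrete_dirs \<gamma> m \<omega>) k X = class_count D (discrete_dirs \<gamma> m \<omega>') k X"
    if "k \<le> card D" "X \<subseteq> D" for k X
    using eq[of "(k, X)"] that by simp
  from hdrrm_cong[OF D this]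
  show "(hdrrm \<tau> b \<omega> D r \<gamma> m = Some R \<and> P (card (discrete_dirs \<gamma> m \<omega>))) =
    (hdrrm \<tau> b \<omega>' D r \<gamma> m = Some R \<and> P (card (discrete_dirs \<gamma> m \<omega>')))"
    by simp
qed

section \<open>Random directions\<close>

text \<open>Here \<open>j\<close> is a possible outcome, \<open>A j\<close> the event that it occurs
  and \<open>E j\<close> its failure set. Outcomes with \<open>E j\<close> of measure at most
  \<open>\<delta>\<close> contribute at most \<open>\<delta>\<close> in total, since the
  \<open>A j\<close> are disjoint. For the others \<open>A j\<close> forces all \<open>m\<close>
  samples to avoid \<open>E j\<close>, which has probability at most
  \<open>exp (- \<delta> * m)\<close>.\<close>

lemma sampling_union_bound:
  fixes U :: "'a measure" and A :: "'j \<Rightarrow> (nat \<Rightarrow> 'a) set"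
  assumes \<Omega>_def: "\<Omega> = Pi\<^sub>M {..<m} (\<lambda>_. U)"
    and U: "prob_space U" and J: "finite J"
    and E: "\<And>j. j \<in> J \<Longrightarrow> E j \<in> sets U"
    and A: "\<And>j. j \<in> J \<Longrightarrow> A j \<in> sets \<Omega>" "disjoint_family_on A J"
    and AE: "\<And>j. j \<in> J \<Longrightarrow> AE \<omega> in \<Omega>. \<omega> \<in> A j \<longrightarrow> (\<forall>i<m. \<omega> i \<notin> E j)"
    and \<delta>: "0 \<le> \<delta>" "real (card {j \<in> J. \<delta> < measure U (E j)}) * exp (- \<delta> * real m) \<le> \<delta>"
  shows "measure (U \<Otimes>\<^sub>M \<Omega>) (\<Union>j\<in>J. E j \<times> A j) \<le> 2 * \<delta>"
proof -
  interpret U: prob_space U by fact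
  interpret Om: prob_space \<Omega> unfolding \<Omega>_def by (rule prob_space_PiM[OF U])
  interpret prod: product_prob_space "\<lambda>_::nat. U" by unfold_locales
  interpret pair_prob_space U \<Omega> by unfold_locales
  have q: "Om.prob (A j) \<le> (1 - U.prob (E j)) ^ m" if "j \<in> J" for j
  proof -
    define C where "C = PiE {..<m} (\<lambda>_. space U - E j)"
    have meas: "space U - E j \<in> sets U" using E[OF that] by simp
    then have C: "C \<in> sets \<Omega>" unfolding C_def \<Omega>_def by (intro sets_PiM_I_finite) auto
    have "emeasure \<Omega> C = (\<Prod>i\<in>{..<m}. emeasure U (space U - E j))"
      unfolding C_def \<Omega>_def using meas by (intro prod.emeasure_PiM) auto
    also have "\<dots> = ennreal ((1 - U.prob (E j)) ^ m)"
      using U.prob_compl[OF E[OF that]] by (simp add: U.emeasure_eq_measure ennreal_power)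
    finally have "Om.prob C = (1 - U.prob (E j)) ^ m"
      by (simp add: Om.emeasure_eq_measure)
    moreover have "Om.prob (A j) \<le> Om.prob C"
    proof (rule Om.finite_measure_mono_AE[OF _ C])
      show "AE \<omega> in \<Omega>. \<omega> \<in> A j \<longrightarrow> \<omega> \<in> C"
        using AE[OF that] AE_space
      proof eventually_elim
        case (elim \<omega>)
        then show ?case by (auto simp: C_def \<Omega>_def space_PiM PiE_iff)
      qed
    qed
    ultimately show ?thesis by simp
  qed
  have qsum: "(\<Sum>j\<in>J. Om.prob (A j)) \<le> 1"
  proof -
    have "A ` J \<subseteq> sets \<Omega>" using A(1) by auto
    from Om.finite_measure_finite_Union[OF J this A(2)] show ?thesis
      using Om.prob_le_1[of "\<Union>j\<in>J. A j"] by simp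
  qed
  let ?J = "{j \<in> J. \<delta> < U.prob (E j)}"
  have EA: "E j \<times> A j \<in> sets (U \<Otimes>\<^sub>M \<Omega>)" if "j \<in> J" for j
    using E[OF that] A(1)[OF that] by simp
  have "prob (\<Union>j\<in>J. E j \<times> A j) \<le> (\<Sum>j\<in>J. prob (E j \<times> A j))"
    using J EA by (intro finite_measure_subadditive_finite) auto
  also have "\<dots> = (\<Sum>j\<in>J. U.prob (E j) * Om.prob (A j))"
    using E A(1) by (intro sum.cong refl)
      (simp add: measure_def Om.emeasure_pair_measure_Times enn2real_mult)
  also have "\<dots> \<le> (\<Sum>j\<in>J. \<delta> * Om.prob (A j) + (if \<delta> < U.prob (E j) then exp (- \<delta> * real m) else 0))"
  proof (rule sum_mono)
    fix j assume j: "j \<in> J"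
    show "U.prob (E j) * Om.prob (A j) \<le> \<delta> * Om.prob (A j) + (if \<delta> < U.prob (E j) then exp (- \<delta> * real m) else 0)"
    proof (cases "\<delta> < U.prob (E j)")
      case True
      have "U.prob (E j) * Om.prob (A j) \<le> 1 * Om.prob (A j)"
        by (intro mult_right_mono) auto
      also have "\<dots> \<le> (1 - U.prob (E j)) ^ m" using q[OF j] by simp
      also have "\<dots> \<le> (exp (- \<delta>)) ^ m"
      proof (rule power_mono)
        have "1 + (- \<delta>) \<le> exp (- \<delta>)" by (rule exp_ge_add_one_self)
        then show "1 - U.prob (E j) \<le> exp (- \<delta>)" using True by linarith
      qed simp
      also have "\<dots> = exp (- \<delta> * real m)" by (rule exp_of_nat2_mult[symmetric])
      finally show ?thesis using True \<delta>(1) by (simp add: add_increasing)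
    next
      case False
      then show ?thesis by (simp add: mult_right_mono)
    qed
  qed
  also have "\<dots> = \<delta> * (\<Sum>j\<in>J. Om.prob (A j)) + real (card ?J) * exp (- \<delta> * real m)"
    using J by (simp add: sum.distrib sum_distrib_left sum.If_cases Int_def conj_commute)
  also have "\<dots> \<le> \<delta> * 1 + \<delta>"
    using qsum \<delta> by (intro add_mono mult_left_mono) auto
  finally show ?thesis by simp
qed

text \<open>Each such set is the image of a map from \<open>{..<r}\<close> to \<open>D\<close>:
  enumerate it and pad with its first element, which exists by nonemptiness.\<close>

lemma card_subsets_le_power:
  assumes "finite D"
  shows "card {R. R \<subseteq> D \<and> R \<noteq> {} \<and> card R \<le> r} \<le> card D ^ r"
proof -
  let ?F = "PiE {..<r} (\<lambda>_. D)"
  have "{R. R \<subseteq> D \<and> R \<noteq> {} \<and> card R \<le> r} \<subseteq> (\<lambda>f. f ` {..<r}) ` ?F"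
  proof
    fix R assume "R \<in> {R. R \<subseteq> D \<and> R \<noteq> {} \<and> card R \<le> r}"
    then have R: "R \<subseteq> D" "R \<noteq> {}" "card R \<le> r" by auto
    then have fin: "finite R" using assms finite_subset by blast
    obtain h where h: "bij_betw h {0..<card R} R" using ex_bij_betw_nat_finite[OF fin] by blast
    have pos: "0 < card R" using R fin by (simp add: card_gt_0_iff)
    define f where "f = restrict (\<lambda>i. if i < card R then h i else h 0) {..<r}"
    have img: "h ` {0..<card R} = R" using h by (simp add: bij_betw_def)
    have hR: "h i \<in> R" if "i < card R" for i using bij_betwE[OF h] that by simp
    have "f ` {..<r} = R"
    proof
      show "f ` {..<r} \<subseteq> R" using hR pos by (auto simp: f_def)
      show "R \<subseteq> f ` {..<r}"
      proof
        fix x assume "x \<in> R"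
        then have "x \<in> h ` {0..<card R}" unfolding img .
        then obtain i where "i < card R" "x = h i" by auto
        then show "x \<in> f ` {..<r}" using R(3) by (intro image_eqI[of _ _ i]) (auto simp: f_def)
      qed
    qed
    moreover have "f \<in> ?F" using hR pos R(1) by (auto simp: f_def)
    ultimately show "R \<in> (\<lambda>f. f ` {..<r}) ` ?F" by blast
  qed
  moreover have "finite ?F" using assms by (intro finite_PiE) auto
  ultimately have "card {R. R \<subseteq> D \<and> R \<noteq> {} \<and> card R \<le> r} \<le> card ?F"
    by (meson card_image_le card_mono finite_imageI le_trans)
  then show ?thesis by (simp add: card_PiE)
qed

text \<open>With \<open>L = ln n\<close> the exponent \<open>\<delta> * m / 2\<close> is at least
  \<open>6 * r * L / \<delta>\<close>. Two of the six parts absorb \<open>(r + 1) * L\<close>; the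
  other four leave at least \<open>2 / \<delta>\<close>, since \<open>r * L \<ge> 1 / 2\<close>, and
  \<open>exp (- 2 / \<delta>) \<le> \<delta> / 2\<close>. This is the origin of the constant
  12.\<close>

lemma union_bound_numeric:
  fixes \<delta> :: real and n r m :: nat
  assumes n: "2 \<le> n" and r: "1 \<le> r" and \<delta>: "0 < \<delta>" "\<delta> < 1"
    and m: "12 * real r * ln (real n) / \<delta>\<^sup>2 \<le> real m"
  shows "real (n ^ r * n) * exp (- (\<delta> / 2) * real m) \<le> \<delta> / 2"
proof -
  define L where "L = ln (real n)"
  have "1 / 2 \<le> ln (2::real)" using ln2_ge_two_thirds by simp
  also have "\<dots> \<le> L" unfolding L_def using n by simp
  finally have L: "1 / 2 \<le> L" .
  have rL: "1 / 2 \<le> real r * L"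
    using mult_mono[of 1 "real r" "1 / 2" L] r L by simp
  have "real (n ^ r * n) = exp (L * real (Suc r))"
    using n by (simp add: L_def exp_add exp_of_nat2_mult distrib_left)
  then have "real (n ^ r * n) * exp (- (\<delta> / 2) * real m) = exp (L * real (Suc r) - \<delta> / 2 * real m)"
    by (simp add: exp_add[symmetric])
  also have "\<dots> \<le> exp (- (2 / \<delta>))"
  proof -
    have "\<delta> / 2 * (12 * real r * L / \<delta>\<^sup>2) \<le> \<delta> / 2 * real m"
      using m \<delta> unfolding L_def by (intro mult_left_mono) auto
    moreover have "\<delta> / 2 * (12 * real r * L / \<delta>\<^sup>2) = 6 * (real r * L) / \<delta>"
      using \<delta> by (simp add: power2_eq_square field_simps)
    moreover have "L * real (Suc r) \<le> 2 * (real r * L)"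
      using r L by (simp add: algebra_simps)
    moreover have "2 * (real r * L) \<le> 2 * (real r * L) / \<delta>"
    proof -
      have "0 \<le> 2 * (real r * L)" using rL by linarith
      then have "2 * (real r * L) * \<delta> \<le> 2 * (real r * L)"
        using \<delta> by (intro mult_left_le) auto
      then show ?thesis using \<delta>(1) by (simp only: pos_le_divide_eq)
    qed
    moreover have "2 / \<delta> \<le> 4 * (real r * L) / \<delta>"
      using \<delta> rL by (intro divide_right_mono; linarith)
    moreover have "6 * (real r * L) / \<delta> = 2 * (real r * L) / \<delta> + 4 * (real r * L) / \<delta>"
      by (simp add: add_divide_distrib[symmetric])
    ultimately have "L * real (Suc r) - \<delta> / 2 * real m \<le> - (2 / \<delta>)" by linarith
    then show ?thesis by simp
  qed
  also have "\<dots> = inverse (exp (2 / \<delta>))" by (simp add: exp_minus)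
  also have "\<dots> \<le> inverse (2 / \<delta>)"
  proof (rule le_imp_inverse_le)
    have "1 + 2 / \<delta> \<le> exp (2 / \<delta>)" by (rule exp_ge_add_one_self)
    then show "2 / \<delta> \<le> exp (2 / \<delta>)" by linarith
  qed (use \<delta> in simp)
  finally show ?thesis by simp
qed

text \<open>\<open>sampling_union_bound\<close> is applied at \<open>\<delta> / 2\<close>, an
  outcome being a pair of output and optimal rank. As the size condition is assumed only almost
  surely, the outcomes in \<open>J\<close> exhaust the samples up to a null set.\<close>

lemma hdrrm_probability:
  fixes D :: "(real^('n::{finite,linorder})) set" and b :: "'n \<Rightarrow> real^('n::_)"
  assumes D: "is_dataset D" and b: "boundary_tuples D b" and \<tau>: "is_tie_rule \<tau>"
    and r: "r \<ge> 1" and \<delta>: "0 < \<delta>" "\<delta> < 1" and \<gamma>: "\<gamma> \<ge> 1"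
    and m: "12 * real r * ln (real (card D)) / \<delta>\<^sup>2 \<le> real m"
    and s_def: "s = (\<lambda>\<omega> :: nat \<Rightarrow> real^('n::_). (real r - real CARD('n)) / (1 + ln (real (card (discrete_dirs \<gamma> m \<omega>)))))"
    and s: "AE \<omega> in sample_space m. \<lfloor>s \<omega>\<rfloor> \<ge> 1"
  shows "1 - \<delta> \<le> \<P>(x in uniform_nonneg_sphere \<Otimes>\<^sub>M sample_space m.
               case x of (u, \<omega>) \<Rightarrow>
                 \<exists>R. hdrrm \<tau> b \<omega> D r \<gamma> m = Some R \<and> set_rank D u R \<le> opt_rank D (s \<omega>))"
proof -
  let ?U = "uniform_nonneg_sphere :: (real^('n::_)) measure"
  let ?S = "sample_space m :: (nat \<Rightarrow> real^('n::_)) measure"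
  interpret U: prob_space ?U by (rule prob_space_uniform_nonneg_sphere)
  interpret S: prob_space ?S by (rule prob_space_sample_space)
  interpret P: pair_prob_space ?U ?S by unfold_locales
  define H where "H = (\<lambda>\<omega>. hdrrm \<tau> b \<omega> D r \<gamma> m)"
  define K where "K = (\<lambda>\<omega>. opt_rank D (s \<omega>))"
  define n where "n = card D"
  have finD: "finite D" using D by (simp add: is_dataset_def)
  have B: "range b \<subseteq> D" "range b \<noteq> {}" using b by (auto simp: boundary_tuples_def)
  then have D0: "D \<noteq> {}" by blast
  have n1: "1 \<le> n" using finD D0 by (simp add: n_def Suc_le_eq card_gt_0_iff)
  define \<A> where "\<A> = (\<lambda>(R, k). {\<omega> \<in> space ?S. H \<omega> = Some R \<and> K \<omega> = k})"
  have \<A>: "\<A> j \<in> sets ?S" for j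
    by (cases j)
      (use hdrrm_Collect_sets[OF finD, where P = "\<lambda>c. opt_rank D ((real r - real CARD('n)) / (1 + ln (real c))) = snd j"]
        in \<open>simp add: \<A>_def H_def K_def s_def\<close>)
  define \<E> where "\<E> = (\<lambda>(R, k). {u :: real^('n::_). \<not> set_rank D u R \<le> k})"
  \<comment> \<open>Valid for every sample, not just almost every one: it bounds the possible
    outputs when the success event is decomposed below.\<close>
  have H_sub: "R \<subseteq> D \<and> R \<noteq> {}" if HR: "H \<omega> = Some R" for R \<omega>
  proof -
    obtain k where k: "k \<ge> 1" "R = asms \<tau> D k (range b) (discrete_dirs \<gamma> m \<omega>)"
      using hdrrm_Some_asms[OF HR[unfolded H_def]] by (elim exE conjE)
    show ?thesis
      unfolding k(2) using asms_rank_le(1,2)[OF finD \<tau> discrete_dirs_finite_card(1) B k(1)] by (intro conjI)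
  qed
  have \<E>: "\<E> (R, k) \<in> sets borel" if "R \<subseteq> D" "R \<noteq> {}" for R k
    using set_rank_le_borel[OF finD that, of k] by (simp add: \<E>_def Collect_neg_eq)
  define J where "J = {R. R \<subseteq> D \<and> R \<noteq> {} \<and> card R \<le> r} \<times> {1..n}"
  have finJ: "finite J" using finD by (simp add: J_def)
  define good where "good = (\<lambda>\<omega>. \<exists>R k. (R, k) \<in> J \<and> H \<omega> = Some R \<and> K \<omega> = k \<and> (\<forall>i<m. \<omega> i \<notin> \<E> (R, k)))"
  have good: "AE \<omega> in ?S. good \<omega>"
    using s AE_sample_space
  proof eventually_elim
    case (elim \<omega>)
    obtain R where R: "H \<omega> = Some R" "range b \<subseteq> R" "R \<subseteq> D" "card R \<le> r"
      "\<forall>u\<in>discrete_dirs \<gamma> m \<omega>. set_rank D u R \<le> K \<omega>"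
      unfolding H_def K_def
      by (rule hdrrm_guarantee[OF fun_cong[OF s_def] D b \<tau> \<gamma> elim(2,1)]) (rule that[unfolded H_def K_def], assumption+)
    have "1 \<le> s \<omega>" using elim(1) by linarith
    then have "K \<omega> \<in> {1..n}" unfolding K_def n_def using opt_rank_bounds[OF finD D0] by simp
    moreover have "R \<noteq> {}" using R(2) by auto
    moreover have "\<omega> i \<notin> \<E> (R, K \<omega>)" if "i < m" for i
      using bspec[OF R(5), of "\<omega> i"] that by (auto simp: \<E>_def discrete_dirs_def)
    ultimately have "(R, K \<omega>) \<in> J \<and> H \<omega> = Some R \<and> K \<omega> = K \<omega> \<and> (\<forall>i<m. \<omega> i \<notin> \<E> (R, K \<omega>))"
      using R(1,3,4) by (simp add: J_def)
    then show ?case unfolding good_def by (intro exI)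
  qed
  \<comment> \<open>The set of samples that are not \<open>good\<close> need not be shown
    measurable; enclosing it in a null set is enough.\<close>
  then obtain N where N: "N \<in> null_sets ?S" "{\<omega> \<in> space ?S. \<not> good \<omega>} \<subseteq> N"
    by (auto simp: eventually_ae_filter)
  define Bad where "Bad = (\<Union>j\<in>J. \<E> j \<times> \<A> j)"
  have EJ: "\<E> j \<in> sets ?U" if "j \<in> J" for j
    using that \<E> by (auto simp: J_def)
  have Bad_sets: "Bad \<in> sets (?U \<Otimes>\<^sub>M ?S)"
    unfolding Bad_def using finJ EJ \<A> by (intro sets.finite_UN) auto
  define Ev where "Ev = {x \<in> space (?U \<Otimes>\<^sub>M ?S). case x of (u, \<omega>) \<Rightarrow> \<exists>R. H \<omega> = Some R \<and> set_rank D u R \<le> K \<omega>}"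
  \<comment> \<open>All natural \<open>k\<close> are allowed here, because
    \<open>K \<omega> \<le> n\<close> is known only for samples meeting the size condition.
    Countably many rectangles still give a measurable set.\<close>
  have "Ev = (\<Union>R\<in>{R. R \<subseteq> D \<and> R \<noteq> {}}. \<Union>k. (- \<E> (R, k)) \<times> \<A> (R, k))"
  proof (intro set_eqI iffI)
    fix x assume "x \<in> Ev"
    then obtain u \<omega> R where x: "x = (u, \<omega>)" "\<omega> \<in> space ?S" "H \<omega> = Some R" "set_rank D u R \<le> K \<omega>"
      by (auto simp: Ev_def space_pair_measure)
    then have "x \<in> (- \<E> (R, K \<omega>)) \<times> \<A> (R, K \<omega>)" by (simp add: \<E>_def \<A>_def)
    with H_sub[OF x(3)] show "x \<in> (\<Union>R\<in>{R. R \<subseteq> D \<and> R \<noteq> {}}. \<Union>k. (- \<E> (R, k)) \<times> \<A> (R, k))"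
      by blast
  next
    fix x assume "x \<in> (\<Union>R\<in>{R. R \<subseteq> D \<and> R \<noteq> {}}. \<Union>k. (- \<E> (R, k)) \<times> \<A> (R, k))"
    then obtain R k where "x \<in> (- \<E> (R, k)) \<times> \<A> (R, k)" by blast
    then show "x \<in> Ev" by (auto simp: Ev_def \<E>_def \<A>_def space_pair_measure)
  qed
  moreover have "\<dots> \<in> sets (?U \<Otimes>\<^sub>M ?S)"
  proof (rule sets.finite_UN)
    show "finite {R. R \<subseteq> D \<and> R \<noteq> {}}" using finD by simp
    fix R assume "R \<in> {R. R \<subseteq> D \<and> R \<noteq> {}}"
    then have "\<E> (R, k) \<in> sets borel" for k using \<E> by blast
    then have "(- \<E> (R, k)) \<times> \<A> (R, k) \<in> sets (?U \<Otimes>\<^sub>M ?S)" for k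
      using \<A> by (intro pair_measureI) simp_all
    then show "(\<Union>k. (- \<E> (R, k)) \<times> \<A> (R, k)) \<in> sets (?U \<Otimes>\<^sub>M ?S)"
      by (intro sets.countable_nat_UN image_subsetI)
  qed
  ultimately have Ev_sets: "Ev \<in> sets (?U \<Otimes>\<^sub>M ?S)" by simp
  have null: "UNIV \<times> N \<in> null_sets (?U \<Otimes>\<^sub>M ?S)"
    using N(1) by (intro S.times_in_null_sets2) auto
  have sub: "space (?U \<Otimes>\<^sub>M ?S) - Ev \<subseteq> Bad \<union> UNIV \<times> N"
  proof
    fix x assume x: "x \<in> space (?U \<Otimes>\<^sub>M ?S) - Ev"
    obtain u \<omega> where u: "x = (u, \<omega>)" by fastforce
    have \<omega>: "\<omega> \<in> space ?S" using x by (simp add: u space_pair_measure)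
    show "x \<in> Bad \<union> UNIV \<times> N"
    proof (cases "good \<omega>")
      case False
      then show ?thesis using N(2) \<omega> by (auto simp: u)
    next
      case True
      then obtain R k where R: "(R, k) \<in> J" "H \<omega> = Some R" "K \<omega> = k" by (auto simp: good_def)
      then have "\<not> set_rank D u R \<le> k" using x by (auto simp: Ev_def u)
      then have "(u, \<omega>) \<in> \<E> (R, k) \<times> \<A> (R, k)" using R \<omega> by (simp add: \<E>_def \<A>_def)
      then show ?thesis using R(1) by (auto simp: u Bad_def)
    qed
  qed
  have "measure (?U \<Otimes>\<^sub>M ?S) Bad \<le> 2 * (\<delta> / 2)"
    unfolding Bad_def
  proof (rule sampling_union_bound[OF sample_space_def prob_space_uniform_nonneg_sphere finJ EJ])
    show "\<A> j \<in> sets ?S" for j by (rule \<A>)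
    show "disjoint_family_on \<A> J" by (auto simp: disjoint_family_on_def \<A>_def)
    show "AE \<omega> in ?S. \<omega> \<in> \<A> j \<longrightarrow> (\<forall>i<m. \<omega> i \<notin> \<E> j)" if "j \<in> J" for j
      using good
    proof eventually_elim
      case (elim \<omega>)
      then obtain R k where "H \<omega> = Some R" "K \<omega> = k" "\<forall>i<m. \<omega> i \<notin> \<E> (R, k)" by (auto simp: good_def)
      then show ?case by (cases j) (auto simp: \<A>_def)
    qed
    show "0 \<le> \<delta> / 2" using \<delta> by simp
    show "real (card {j \<in> J. \<delta> / 2 < U.prob (\<E> j)}) * exp (- (\<delta> / 2) * real m) \<le> \<delta> / 2"
    proof (cases "n = 1")
      case True
      have "\<E> j = {}" if "j \<in> J" for j
      proof -
        obtain R k where j: "j = (R, k)" by fastforce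
        then have "R \<subseteq> D" "R \<noteq> {}" "1 \<le> k" using that by (auto simp: J_def)
        then have "set_rank D u R \<le> k" for u
          using set_rank_le_card[OF finD, of R u] True by (simp add: n_def)
        then show ?thesis by (simp add: \<E>_def j)
      qed
      then have empty: "{j \<in> J. \<delta> / 2 < U.prob (\<E> j)} = {}" using \<delta> by auto
      show ?thesis unfolding empty using \<delta> by simp
    next
      case False
      have "card {j \<in> J. \<delta> / 2 < U.prob (\<E> j)} \<le> card J" using finJ by (intro card_mono) auto
      also have "\<dots> \<le> n ^ r * n"
        unfolding J_def card_cartesian_product
        using card_subsets_le_power[OF finD, of r] by (simp add: n_def)
      finally have "real (card {j \<in> J. \<delta> / 2 < U.prob (\<E> j)}) \<le> real (n ^ r * n)"
        by (rule of_nat_mono)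
      then have "real (card {j \<in> J. \<delta> / 2 < U.prob (\<E> j)}) * exp (- (\<delta> / 2) * real m)
          \<le> real (n ^ r * n) * exp (- (\<delta> / 2) * real m)"
        by (intro mult_right_mono) auto
      also have "\<dots> \<le> \<delta> / 2"
        using False n1 r \<delta> m by (intro union_bound_numeric) (auto simp: n_def)
      finally show ?thesis .
    qed
  qed
  then have "P.prob (Bad \<union> UNIV \<times> N) \<le> \<delta>"
    using measure_Un_null_set[OF Bad_sets null] by simp
  moreover have "P.prob (space (?U \<Otimes>\<^sub>M ?S) - Ev) \<le> P.prob (Bad \<union> UNIV \<times> N)"
    using sub Bad_sets null by (intro P.finite_measure_mono) auto
  ultimately have "1 - \<delta> \<le> P.prob Ev"
    using P.prob_compl[OF Ev_sets] by simp
  then show ?thesis by (simp add: Ev_def H_def K_def)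
qed

theorem theorem10:
  assumes "CARD('n::{finite,linorder}) \<ge> 2"
  shows "\<exists>C1 > 0. \<exists>C2 > 0.
    \<forall>(D :: (real^('n::_)) set) (b :: 'n \<Rightarrow> real^('n::_)) (\<tau> :: (real^('n::_)) tie_rule) (r :: nat) (\<delta> :: real) (\<epsilon> :: real).
      is_dataset D \<and> boundary_tuples D b \<and> is_tie_rule \<tau> \<and> r \<ge> 1 \<and>
      \<delta> \<in> {0<..<1} \<and> \<epsilon> \<in> {0<..<1} \<longrightarrow>
      (let n = card D;
           m = nat \<lceil>C1 * real r * ln (real n) / \<delta>\<^sup>2\<rceil>;
           \<gamma> = nat \<lceil>C2 / \<epsilon>\<rceil>;
           \<D> = (\<lambda>\<omega>. discrete_dirs \<gamma> m \<omega>);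
           s = (\<lambda>\<omega>. (real r - real CARD('n)) / (1 + ln (real (card (\<D> \<omega>)))));
           kstar = (\<lambda>\<omega>. opt_rank D (s \<omega>))
       in
         (\<forall>\<omega>. (\<forall>i<m. \<omega> i \<in> nonneg_sphere) \<longrightarrow>
            card (\<D> \<omega>) \<le> (\<gamma> + 1) ^ (CARD('n) - 1) + m \<and>
            (\<lfloor>s \<omega>\<rfloor> \<ge> 1 \<longrightarrow>
              (\<exists>R. hdrrm \<tau> b \<omega> D r \<gamma> m = Some R \<and> R \<subseteq> D \<and>
                 max_rank D (\<D> \<omega>) R \<le> kstar \<omega> \<and> card R \<le> r \<and>
                 (\<forall>u\<in>nonneg_sphere.
                    max_utility u R \<ge> (1 - \<epsilon>) * kth_utility (kstar \<omega>) u D)))) \<and>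
         ((AE \<omega> in sample_space m. \<lfloor>s \<omega>\<rfloor> \<ge> 1) \<longrightarrow>
            \<P>(x in uniform_nonneg_sphere \<Otimes>\<^sub>M sample_space m.
               case x of (u, \<omega>) \<Rightarrow>
                 \<exists>R. hdrrm \<tau> b \<omega> D r \<gamma> m = Some R \<and> set_rank D u R \<le> kstar \<omega>) \<ge> 1 - \<delta>))"
proof -
  define d where "d = real CARD('n)"
  \<comment> \<open>The grid approximates each coordinate up to
    \<open>d * pi / (2 * \<gamma>)\<close>, and \<open>approximation_guarantee\<close> tolerates
    \<open>\<epsilon> / (2 * d^2)\<close>; equating the two gives
    \<open>\<gamma> = d^3 * pi / \<epsilon>\<close>.\<close>
  define C2 where "C2 = d ^ 3 * pi"
  have d: "0 < d" by (simp add: d_def)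
  then have C2: "0 < C2" by (simp add: C2_def)
  show ?thesis
  proof (rule exI[of _ "12 :: real"], intro conjI, simp, rule exI[of _ C2], intro conjI allI impI)
    fix D :: "(real^('n::_)) set" and b :: "'n \<Rightarrow> real^('n::_)" and \<tau> :: "(real^('n::_)) tie_rule"
      and r :: nat and \<delta> \<epsilon> :: real
    assume asm: "is_dataset D \<and> boundary_tuples D b \<and> is_tie_rule \<tau> \<and> r \<ge> 1 \<and>
      \<delta> \<in> {0<..<1} \<and> \<epsilon> \<in> {0<..<1}"
    then have D: "is_dataset D" and b: "boundary_tuples D b" and \<tau>: "is_tie_rule \<tau>" and r: "r \<ge> 1"
      and \<delta>: "0 < \<delta>" "\<delta> < 1" and \<epsilon>: "0 < \<epsilon>" "\<epsilon> < 1" by auto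
    define m where "m = nat \<lceil>12 * real r * ln (real (card D)) / \<delta>\<^sup>2\<rceil>"
    define \<gamma> where "\<gamma> = nat \<lceil>C2 / \<epsilon>\<rceil>"
    define s where "s = (\<lambda>\<omega> :: nat \<Rightarrow> real^('n::_).
      (real r - real CARD('n)) / (1 + ln (real (card (discrete_dirs \<gamma> m \<omega>)))))"
    have m: "12 * real r * ln (real (card D)) / \<delta>\<^sup>2 \<le> real m"
      unfolding m_def by (rule real_nat_ceiling_ge)
    have \<gamma>: "C2 / \<epsilon> \<le> real \<gamma>" unfolding \<gamma>_def by (rule real_nat_ceiling_ge)
    moreover have "0 < C2 / \<epsilon>" using C2 \<epsilon> by simp
    ultimately have \<gamma>1: "\<gamma> \<ge> 1" by linarith
    have finD: "finite D" using D by (simp add: is_dataset_def)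
    have D0: "D \<noteq> {}" using b by (auto simp: boundary_tuples_def)
    have 1: "\<exists>R. hdrrm \<tau> b \<omega> D r \<gamma> m = Some R \<and> R \<subseteq> D \<and>
                 max_rank D (discrete_dirs \<gamma> m \<omega>) R \<le> opt_rank D (s \<omega>) \<and> card R \<le> r \<and>
                 (\<forall>u\<in>nonneg_sphere.
                    max_utility u R \<ge> (1 - \<epsilon>) * kth_utility (opt_rank D (s \<omega>)) u D)"
      if \<omega>: "\<forall>i<m. \<omega> i \<in> nonneg_sphere" and s1: "\<lfloor>s \<omega>\<rfloor> \<ge> 1" for \<omega> :: "nat \<Rightarrow> real^('n::_)"
    proof -
      obtain R where R: "hdrrm \<tau> b \<omega> D r \<gamma> m = Some R" "range b \<subseteq> R" "R \<subseteq> D" "card R \<le> r"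
        "\<forall>u\<in>discrete_dirs \<gamma> m \<omega>. set_rank D u R \<le> opt_rank D (s \<omega>)"
        "max_rank D (discrete_dirs \<gamma> m \<omega>) R \<le> opt_rank D (s \<omega>)"
        by (rule hdrrm_guarantee[OF fun_cong[OF s_def] D b \<tau> \<gamma>1 \<omega> s1]) (rule that, assumption+)
      have k: "1 \<le> opt_rank D (s \<omega>)" "opt_rank D (s \<omega>) \<le> card D"
        using s1 by (intro opt_rank_bounds[OF finD D0]; linarith)+
      have "(1 - \<epsilon>) * kth_utility (opt_rank D (s \<omega>)) u D \<le> max_utility u R"
        if u: "u \<in> nonneg_sphere" for u
      proof -
        obtain v where v: "v \<in> polar_grid \<gamma>"
          "\<And>i. \<bar>u $ i - v $ i\<bar> \<le> real CARD('n) * (pi / (2 * real \<gamma>))"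
          using polar_grid_net[OF u \<gamma>1] by blast
        have "d * (pi / (2 * real \<gamma>)) \<le> \<epsilon> / (2 * d ^ 2)"
        proof -
          have "d ^ 3 * pi \<le> real \<gamma> * \<epsilon>" using \<gamma> \<epsilon> by (simp add: C2_def field_simps)
          then show ?thesis using d \<gamma>1 by (simp add: field_simps power2_eq_square power3_eq_cube)
        qed
        then have close: "\<bar>u $ i - v $ i\<bar> \<le> \<epsilon> / (2 * real CARD('n) ^ 2)" for i
          using v(2)[of i] unfolding d_def by linarith
        have "set_rank D v R \<le> opt_rank D (s \<omega>)"
          using v(1) by (intro bspec[OF R(5)]) (simp add: discrete_dirs_def)
        then show ?thesis
          by (rule approximation_guarantee[OF D b R(3,2) k u \<epsilon> _ close])
      qed
      then show ?thesis using R by blast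
    qed
    have 2: "(AE \<omega> in sample_space m. \<lfloor>s \<omega>\<rfloor> \<ge> 1) \<Longrightarrow>
            \<P>(x in uniform_nonneg_sphere \<Otimes>\<^sub>M sample_space m.
               case x of (u, \<omega>) \<Rightarrow>
                 \<exists>R. hdrrm \<tau> b \<omega> D r \<gamma> m = Some R \<and> set_rank D u R \<le> opt_rank D (s \<omega>)) \<ge> 1 - \<delta>"
      by (rule hdrrm_probability[OF D b \<tau> r \<delta> \<gamma>1 m s_def])
    show "let n = card D;
           m = nat \<lceil>12 * real r * ln (real n) / \<delta>\<^sup>2\<rceil>;
           \<gamma> = nat \<lceil>C2 / \<epsilon>\<rceil>;
           \<D> = (\<lambda>\<omega>. discrete_dirs \<gamma> m \<omega>);
           s = (\<lambda>\<omega>. (real r - real CARD('n)) / (1 + ln (real (card (\<D> \<omega>)))));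
           kstar = (\<lambda>\<omega>. opt_rank D (s \<omega>))
       in
         (\<forall>\<omega>. (\<forall>i<m. \<omega> i \<in> nonneg_sphere) \<longrightarrow>
            card (\<D> \<omega>) \<le> (\<gamma> + 1) ^ (CARD('n) - 1) + m \<and>
            (\<lfloor>s \<omega>\<rfloor> \<ge> 1 \<longrightarrow>
              (\<exists>R. hdrrm \<tau> b \<omega> D r \<gamma> m = Some R \<and> R \<subseteq> D \<and>
                 max_rank D (\<D> \<omega>) R \<le> kstar \<omega> \<and> card R \<le> r \<and>
                 (\<forall>u\<in>nonneg_sphere.
                    max_utility u R \<ge> (1 - \<epsilon>) * kth_utility (kstar \<omega>) u D)))) \<and>
         ((AE \<omega> in sample_space m. \<lfloor>s \<omega>\<rfloor> \<ge> 1) \<longrightarrow>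
            \<P>(x in uniform_nonneg_sphere \<Otimes>\<^sub>M sample_space m.
               case x of (u, \<omega>) \<Rightarrow>
                 \<exists>R. hdrrm \<tau> b \<omega> D r \<gamma> m = Some R \<and> set_rank D u R \<le> kstar \<omega>) \<ge> 1 - \<delta>)"
      unfolding Let_def m_def[symmetric] \<gamma>_def[symmetric]
      using 1 2 discrete_dirs_finite_card(2)[of \<gamma> m] unfolding s_def by blast
  qed (use C2 in auto)
qed

end
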